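(* Let $\mathcal P$ be a finite connected poset with at least $2$ elements, and let $\mathcal X_2=\{1\to2\}$ be the totally ordered poset with two elements $1<2$. Then the invariants $\mathbf{rk}_{\mathcal P}$ and $\mathbf{mult}_{\mathcal X_2,\mathcal P}$ are equivalent.
   Context: Fix a field $k$. For a finite poset $\mathcal P$, $\mathrm{mod}\,\mathcal P$ is the category of functors from $\mathcal P$ to finite-dimensional $k$-vector spaces; $\mathrm{Ind}\,\mathcal P$ is a set of representatives of isoclasses of indecomposables. For a $\mathcal P$-module $M$ and $a\le b$, $M_{a\to b}:M_a\to M_b$ is the structure map. $\mathrm K_0^{\mathrm{sp}}(\mathcal P)$ is the split Grothendieck group (isoclasses $[M]$ modulo $[M\oplus N]=[M]+[N]$). An invariant on $\mathrm{mod}\,\mathcal P$ is a $\mathbb Z$-linear map $\Phi:\mathrm K_0^{\mathrm{sp}}(\mathcal P)\to\mathbb Z^I$. Invariants $\Phi_1,\Phi_2$ are equivalent if there is an isomorphism $\varphi:\mathrm{Im}\,\Phi_1\to\mathrm{Im}\,\Phi_2$ with $\varphi\circ\Phi_1=\Phi_2$. The rank invariant is $\mathbf{rk}_{\mathcal P}:\mathrm K_0^{\mathrm{sp}}(\mathcal P)\to\mathbb Z^{\{\le_{\mathcal P}\}}$, $(\mathbf{rk}_{\mathcal P}(M))_{(a,b)}=\mathrm{rk}\,M_{a\to b}$, where $\{\le_{\mathcal P}\}=\{(a,b)\in\mathcal P^2\mid a\le b\}$. An order-embedding $f:\mathcal X\to\mathcal P$ is a map with $x\le x'\iff f(x)\le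 f(x')$; $\mathrm{Emb}_{\mathcal X}^{\mathcal P}$ is the set of order-embeddings up to precomposition with automorphisms of $\mathcal X$. $f^*:\mathrm{mod}\,\mathcal P\to\mathrm{mod}\,\mathcal X$ is restriction along $f$. For $\mathcal X$ with $\mathrm{Ind}\,\mathcal X$ finite (as for $\mathcal X_2$), $\mathbf{mult}_{\mathcal X,\mathcal P}:\mathrm K_0^{\mathrm{sp}}(\mathcal P)\to\mathbb Z^{\mathrm{Emb}_{\mathcal X}^{\mathcal P}\times\mathrm{Ind}\,\mathcal X}$ is given by $(\mathbf{mult}_{\mathcal X,\mathcal P}(M))_{(f,U)}=$ multiplicity of $U$ as a direct summand of $f^*M$. *)

theory Defs
  imports Complex_Main "HOL-Algebra.Free_Abelian_Groups" "HOL-Library.Function_Algebras"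
begin

text \<open>
  A finite poset is a type of class \<open>{finite, order}\<close>, and the ground field is a type of class
  \<open>field\<close>.

  Finite-dimensional vector spaces over \<open>'k\<close> are realised as the finite-dimensional subspaces of
  the space \<open>nat \<Rightarrow> 'k\<close> of sequences. Some universe of vector spaces has to be fixed in order to
  form sets of isomorphism classes; this one contains a copy of every finite-dimensional
  \<open>'k\<close>-space and is closed under direct sums (see \<open>interleave\<close>).
\<close>

definition sscale :: "'k::field \<Rightarrow> (nat \<Rightarrow> 'k) \<Rightarrow> nat \<Rightarrow> 'k"
  where "sscale c v = (\<lambda>i. c * v i)"

global_interpretation kseq: vector_space "sscale :: 'k::field \<Rightarrow> (nat \<Rightarrow> 'k) \<Rightarrow> nat \<Rightarrow> 'k"
  by unfold_locales (auto simp: sscale_def fun_eq_iff algebra_simps)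

definition fd_space :: "(nat \<Rightarrow> 'k::field) set \<Rightarrow> bool"
  where "fd_space V \<longleftrightarrow> (\<exists>B. finite B \<and> V = kseq.span B)"

definition linear_on ::
  "(nat \<Rightarrow> 'k::field) set \<Rightarrow> (nat \<Rightarrow> 'k) set \<Rightarrow> ((nat \<Rightarrow> 'k) \<Rightarrow> nat \<Rightarrow> 'k) \<Rightarrow> bool"
  where "linear_on V W h \<longleftrightarrow> h \<in> V \<rightarrow> W \<and>
    (\<forall>u\<in>V. \<forall>v\<in>V. h (u + v) = h u + h v) \<and>
    (\<forall>c. \<forall>v\<in>V. h (sscale c v) = sscale c (h v))"


section \<open>Modules over a finite poset\<close>

text \<open>
  \<open>pmap M a b\<close> is the structure map from \<open>pspace M a\<close> to \<open>pspace M b\<close>. It is meaningful only for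
  \<open>a \<le> b\<close> and on \<open>pspace M a\<close>; everything below is insensitive to its other values.
\<close>

record ('p, 'k) pmod =
  pspace :: "'p \<Rightarrow> (nat \<Rightarrow> 'k) set"
  pmap :: "'p \<Rightarrow> 'p \<Rightarrow> (nat \<Rightarrow> 'k) \<Rightarrow> nat \<Rightarrow> 'k"

definition is_pmod :: "('p::{finite,order}, 'k::field) pmod \<Rightarrow> bool"
  where "is_pmod M \<longleftrightarrow>
    (\<forall>a. fd_space (pspace M a)) \<and>
    (\<forall>a b. a \<le> b \<longrightarrow> linear_on (pspace M a) (pspace M b) (pmap M a b)) \<and>
    (\<forall>a. \<forall>v\<in>pspace M a. pmap M a a v = v) \<and>
    (\<forall>a b c. a \<le> b \<longrightarrow> b \<le> c \<longrightarrow>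
      (\<forall>v\<in>pspace M a. pmap M b c (pmap M a b v) = pmap M a c v))"

definition pmod_iso ::
  "('p::{finite,order}, 'k::field) pmod \<Rightarrow> ('p, 'k) pmod \<Rightarrow> bool"
  where "pmod_iso M N \<longleftrightarrow> (\<exists>h.
    (\<forall>a. linear_on (pspace M a) (pspace N a) (h a) \<and>
         bij_betw (h a) (pspace M a) (pspace N a)) \<and>
    (\<forall>a b. a \<le> b \<longrightarrow>
      (\<forall>v\<in>pspace M a. h b (pmap M a b v) = pmap N a b (h a v))))"

text \<open>
  \<open>(u, v) \<mapsto> interleave u v\<close> is a linear isomorphism from the (external) direct sum of two copies of
  the sequence space onto the sequence space, with inverse \<open>w \<mapsto> (evens w, odds w)\<close>. It encodes
  pairs, so that the external direct sum of two spaces of sequences is again one.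
\<close>

definition interleave :: "(nat \<Rightarrow> 'k) \<Rightarrow> (nat \<Rightarrow> 'k) \<Rightarrow> nat \<Rightarrow> 'k"
  where "interleave u v = (\<lambda>n. if even n then u (n div 2) else v (n div 2))"

definition evens :: "(nat \<Rightarrow> 'k) \<Rightarrow> nat \<Rightarrow> 'k"
  where "evens w = (\<lambda>n. w (2 * n))"

definition odds :: "(nat \<Rightarrow> 'k) \<Rightarrow> nat \<Rightarrow> 'k"
  where "odds w = (\<lambda>n. w (2 * n + 1))"

definition dsum ::
  "('p::{finite,order}, 'k::field) pmod \<Rightarrow> ('p, 'k) pmod \<Rightarrow> ('p, 'k) pmod"  (infixr \<open>\<oplus>\<^sub>p\<close> 65)
  where "M \<oplus>\<^sub>p N =
    \<lparr>pspace = (\<lambda>a. {interleave u v |u v. u \<in> pspace M a \<and> v \<in> pspace N a}),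
     pmap = (\<lambda>a b w. interleave (pmap M a b (evens w)) (pmap N a b (odds w)))\<rparr>"

definition zero_pmod :: "('p::{finite,order}, 'k::field) pmod"
  where "zero_pmod = \<lparr>pspace = (\<lambda>a. {0}), pmap = (\<lambda>a b v. v)\<rparr>"

primrec dpower :: "nat \<Rightarrow> ('p::{finite,order}, 'k::field) pmod \<Rightarrow> ('p, 'k) pmod"
  where
    "dpower 0 U = zero_pmod"
  | "dpower (Suc n) U = U \<oplus>\<^sub>p dpower n U"

definition indecomposable :: "('p::{finite,order}, 'k::field) pmod \<Rightarrow> bool"
  where "indecomposable M \<longleftrightarrow> is_pmod M \<and> \<not> pmod_iso M zero_pmod \<and>
    (\<forall>N L. is_pmod N \<longrightarrow> is_pmod L \<longrightarrow> pmod_iso M (N \<oplus>\<^sub>p L) \<longrightarrow>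
      pmod_iso N zero_pmod \<or> pmod_iso L zero_pmod)"

lemma interleave_add: "interleave (u + u') (v + v') = interleave u v + interleave u' v'"
  by (auto simp: interleave_def fun_eq_iff)

lemma interleave_scale: "interleave (sscale c u) (sscale c v) = sscale c (interleave u v)"
  by (auto simp: interleave_def sscale_def fun_eq_iff)

lemma evens_interleave [simp]: "evens (interleave u v) = u"
  by (auto simp: interleave_def evens_def fun_eq_iff)

lemma odds_interleave [simp]: "odds (interleave u v) = v"
  by (auto simp: interleave_def odds_def fun_eq_iff)

lemma fd_space_interleave:
  assumes "fd_space V" "fd_space W"
  shows "fd_space {interleave u v |u v. u \<in> V \<and> v \<in> W}"
proof -
  obtain B C where B: "finite B" "V = kseq.span B" and C: "finite C" "W = kseq.span C"
    using assms by (auto simp: fd_space_def)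
  interpret L: Vector_Spaces.linear sscale sscale "\<lambda>u :: nat \<Rightarrow> 'a. interleave u 0"
    by unfold_locales (simp_all flip: interleave_add interleave_scale)
  interpret R: Vector_Spaces.linear sscale sscale "\<lambda>v :: nat \<Rightarrow> 'a. interleave 0 v"
    by unfold_locales (simp_all flip: interleave_add interleave_scale)
  let ?D = "(\<lambda>u. interleave u 0) ` B \<union> (\<lambda>v. interleave 0 v) ` C"
  have eq: "interleave u v = interleave u 0 + interleave 0 v" for u v :: "nat \<Rightarrow> 'a"
    by (simp flip: interleave_add)
  have "kseq.span ?D = {x + y |x y. x \<in> (\<lambda>u. interleave u 0) ` V \<and> y \<in> (\<lambda>v. interleave 0 v) ` W}"
    by (simp add: kseq.span_Un L.span_image R.span_image B C)
  also have "\<dots> = {interleave u v |u v. u \<in> V \<and> v \<in> W}"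
    by (subst (3) eq) blast
  finally show ?thesis
    using B C unfolding fd_space_def by (metis finite_UnI finite_imageI)
qed

lemma linear_on_dsum:
  assumes "linear_on V V' f" "linear_on W W' g"
  shows "linear_on {interleave u v |u v. u \<in> V \<and> v \<in> W} {interleave u v |u v. u \<in> V' \<and> v \<in> W'}
    (\<lambda>w. interleave (f (evens w)) (g (odds w)))"
proof -
  let ?D = "{interleave u v |u v. u \<in> V \<and> v \<in> W}"
  let ?h = "\<lambda>w. interleave (f (evens w)) (g (odds w))"
  note f = assms(1)[unfolded linear_on_def] and g = assms(2)[unfolded linear_on_def]
  have "?h w \<in> {interleave u v |u v. u \<in> V' \<and> v \<in> W'}" if w: "w \<in> ?D" for w
  proof -
    obtain u v where uv: "w = interleave u v" "u \<in> V" "v \<in> W"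
      using w by blast
    then have "f u \<in> V'" "g v \<in> W'"
      using f g by (blast dest: funcset_mem)+
    then show ?thesis
      unfolding uv(1) evens_interleave odds_interleave by blast
  qed
  moreover have "?h (w + w') = ?h w + ?h w'" if w: "w \<in> ?D" and w': "w' \<in> ?D" for w w'
  proof -
    obtain u v where uv: "w = interleave u v" "u \<in> V" "v \<in> W"
      using w by blast
    obtain u' v' where uv': "w' = interleave u' v'" "u' \<in> V" "v' \<in> W"
      using w' by blast
    have "f (u + u') = f u + f u'" "g (v + v') = g v + g v'"
      using f g uv uv' by blast+
    then show ?thesis
      unfolding uv(1) uv'(1) interleave_add[symmetric] evens_interleave odds_interleave
      by (simp only: interleave_add)
  qed
  moreover have "?h (sscale c w) = sscale c (?h w)" if w: "w \<in> ?D" for c w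
  proof -
    obtain u v where uv: "w = interleave u v" "u \<in> V" "v \<in> W"
      using w by blast
    have "f (sscale c u) = sscale c (f u)" "g (sscale c v) = sscale c (g v)"
      using f g uv by blast+
    then show ?thesis
      unfolding uv(1) interleave_scale[symmetric] evens_interleave odds_interleave
      by (simp only: interleave_scale)
  qed
  ultimately show ?thesis
    unfolding linear_on_def by blast
qed

lemma is_pmod_dsum:
  assumes M: "is_pmod M" and N: "is_pmod N"
  shows "is_pmod (M \<oplus>\<^sub>p N)"
proof -
  have "fd_space (pspace (M \<oplus>\<^sub>p N) a)" for a
    using M N by (simp add: is_pmod_def dsum_def fd_space_interleave)
  moreover have "linear_on (pspace (M \<oplus>\<^sub>p N) a) (pspace (M \<oplus>\<^sub>p N) b) (pmap (M \<oplus>\<^sub>p N) a b)"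
    if "a \<le> b" for a b
    using M N that by (simp add: is_pmod_def dsum_def linear_on_dsum)
  moreover have "pmap (M \<oplus>\<^sub>p N) a a v = v" if "v \<in> pspace (M \<oplus>\<^sub>p N) a" for a v
    using M N that by (auto simp: is_pmod_def dsum_def)
  moreover have "pmap (M \<oplus>\<^sub>p N) b c (pmap (M \<oplus>\<^sub>p N) a b v) = pmap (M \<oplus>\<^sub>p N) a c v"
    if le: "a \<le> b" "b \<le> c" and mem: "v \<in> pspace (M \<oplus>\<^sub>p N) a" for a b c v
  proof -
    obtain u w where v: "v = interleave u w" "u \<in> pspace M a" "w \<in> pspace N a"
      using mem by (auto simp: dsum_def)
    then show ?thesis
      using M N le by (simp add: is_pmod_def dsum_def)
  qed
  ultimately show ?thesis
    by (subst is_pmod_def) (intro conjI allI impI ballI; assumption?; simp)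
qed

text \<open>\<open>is_Ind S\<close>: \<open>S\<close> is a set of representatives of the isoclasses of indecomposables.\<close>

definition is_Ind :: "('p::{finite,order}, 'k::field) pmod set \<Rightarrow> bool"
  where "is_Ind S \<longleftrightarrow> S \<subseteq> {U. indecomposable U} \<and>
    (\<forall>M. indecomposable M \<longrightarrow> (\<exists>!U. U \<in> S \<and> pmod_iso M U))"

text \<open>
  The multiplicity of \<open>U\<close> as a direct summand of \<open>M\<close>: the largest \<open>n\<close> such that the direct sum of
  \<open>n\<close> copies of \<open>U\<close> is a direct summand of \<open>M\<close>.
\<close>

definition multiplicity ::
  "('p::{finite,order}, 'k::field) pmod \<Rightarrow> ('p, 'k) pmod \<Rightarrow> nat"
  where "multiplicity U M =
    (GREATEST n. \<exists>L. is_pmod L \<and> pmod_iso M (dpower n U \<oplus>\<^sub>p L))"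


section \<open>The split Grothendieck group and invariants\<close>

definition pmod_iso_rel :: "(('p::{finite,order}, 'k::field) pmod) rel"
  where "pmod_iso_rel = {(M, N). is_pmod M \<and> is_pmod N \<and> pmod_iso M N}"

definition isoclasses :: "('p::{finite,order}, 'k::field) pmod set set"
  where "isoclasses = {M. is_pmod M} // pmod_iso_rel"

definition isoclass ::
  "('p::{finite,order}, 'k::field) pmod \<Rightarrow> ('p, 'k) pmod set"
  where "isoclass M = pmod_iso_rel `` {M}"

definition K0_relations :: "(('p::{finite,order}, 'k::field) pmod set \<Rightarrow>\<^sub>0 int) set"
  where "K0_relations =
    {frag_of (isoclass (M \<oplus>\<^sub>p N)) - (frag_of (isoclass M) + frag_of (isoclass N)) |M N.
      is_pmod M \<and> is_pmod N}"

definition K0_subgroup :: "(('p::{finite,order}, 'k::field) pmod set \<Rightarrow>\<^sub>0 int) set"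
  where "K0_subgroup = generate (free_Abelian_group isoclasses) K0_relations"

definition K0sp :: "(('p::{finite,order}, 'k::field) pmod set \<Rightarrow>\<^sub>0 int) set monoid"
  where "K0sp = free_Abelian_group isoclasses Mod K0_subgroup"

definition K0_class ::
  "('p::{finite,order}, 'k::field) pmod \<Rightarrow> (('p, 'k) pmod set \<Rightarrow>\<^sub>0 int) set"
  where "K0_class M = K0_subgroup #>\<^bsub>free_Abelian_group isoclasses\<^esub> frag_of (isoclass M)"

text \<open>The group of integer-valued functions on the index set \<open>I\<close>.\<close>

abbreviation Zpow :: "'i set \<Rightarrow> ('i \<Rightarrow> int) monoid"
  where "Zpow I \<equiv> product_group I (\<lambda>_. integer_group)"

definition invariant ::
  "'i set \<Rightarrow> ((('p::{finite,order}, 'k::field) pmod set \<Rightarrow>\<^sub>0 int) set \<Rightarrow> 'i \<Rightarrow> int) \<Rightarrow> bool"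
  where "invariant I \<Phi> \<longleftrightarrow> \<Phi> \<in> hom K0sp (Zpow I)"

definition invariant_image ::
  "'i set \<Rightarrow> ((('p::{finite,order}, 'k::field) pmod set \<Rightarrow>\<^sub>0 int) set \<Rightarrow> 'i \<Rightarrow> int)
    \<Rightarrow> ('i \<Rightarrow> int) monoid"
  where "invariant_image I \<Phi> = (Zpow I)\<lparr>carrier := \<Phi> ` carrier K0sp\<rparr>"

text \<open>Equivalence of the invariants \<open>\<Phi>\<close> with values in \<open>Zpow I\<close> and \<open>\<Psi>\<close> with values in \<open>Zpow J\<close>.\<close>

definition equivalent_invariants ::
  "'i set \<Rightarrow> ((('p::{finite,order}, 'k::field) pmod set \<Rightarrow>\<^sub>0 int) set \<Rightarrow> 'i \<Rightarrow> int) \<Rightarrow>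
   'j set \<Rightarrow> ((('p, 'k) pmod set \<Rightarrow>\<^sub>0 int) set \<Rightarrow> 'j \<Rightarrow> int) \<Rightarrow> bool"
  where "equivalent_invariants I \<Phi> J \<Psi> \<longleftrightarrow> invariant I \<Phi> \<and> invariant J \<Psi> \<and>
    (\<exists>\<phi> \<in> iso (invariant_image I \<Phi>) (invariant_image J \<Psi>). \<forall>x \<in> carrier K0sp. \<phi> (\<Phi> x) = \<Psi> x)"

text \<open>
  \<open>K0_lift I \<phi>\<close> is the homomorphism from \<open>K0sp\<close> to \<open>Zpow I\<close> that sends the class of each module \<open>M\<close>
  to \<open>\<phi> M\<close>. It exists as soon as \<open>\<phi>\<close> is invariant under isomorphism and additive on direct sums
  (lemmas \<open>K0_lift_hom\<close> and \<open>K0_lift_class\<close> below), and it is unique because the classes of modules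
  generate \<open>K0sp\<close>.
\<close>

definition K0_lift ::
  "'i set \<Rightarrow> (('p::{finite,order}, 'k::field) pmod \<Rightarrow> 'i \<Rightarrow> int)
    \<Rightarrow> (('p, 'k) pmod set \<Rightarrow>\<^sub>0 int) set \<Rightarrow> 'i \<Rightarrow> int"
  where "K0_lift I \<phi> = (THE F. F \<in> hom K0sp (Zpow I) \<and> F \<in> extensional (carrier K0sp) \<and>
    (\<forall>M. is_pmod M \<longrightarrow> F (K0_class M) = restrict (\<phi> M) I))"


lemma pmod_iso_refl: "is_pmod M \<Longrightarrow> pmod_iso M M"
  unfolding pmod_iso_def
  by (rule exI[of _ "\<lambda>_ v. v"]) (auto simp: linear_on_def bij_betw_def)

lemma pmod_iso_trans:
  assumes "is_pmod M" "pmod_iso M N" "pmod_iso N L"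
  shows "pmod_iso M L"
proof -
  obtain h where h: "\<And>a. linear_on (pspace M a) (pspace N a) (h a)"
      "\<And>a. bij_betw (h a) (pspace M a) (pspace N a)"
      "\<And>a b v. a \<le> b \<Longrightarrow> v \<in> pspace M a \<Longrightarrow> h b (pmap M a b v) = pmap N a b (h a v)"
    using assms(2) unfolding pmod_iso_def by metis
  obtain g where g: "\<And>a. linear_on (pspace N a) (pspace L a) (g a)"
      "\<And>a. bij_betw (g a) (pspace N a) (pspace L a)"
      "\<And>a b v. a \<le> b \<Longrightarrow> v \<in> pspace N a \<Longrightarrow> g b (pmap N a b v) = pmap L a b (g a v)"
    using assms(3) unfolding pmod_iso_def by metis
  have hN: "h a v \<in> pspace N a" if "v \<in> pspace M a" for a v
    using h(1)[of a] that by (auto simp: linear_on_def)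
  have "linear_on (pspace M a) (pspace L a) (\<lambda>v. g a (h a v))" for a
    using h(1)[of a] g(1)[of a] by (simp add: linear_on_def Pi_iff)
  moreover have "bij_betw (\<lambda>v. g a (h a v)) (pspace M a) (pspace L a)" for a
    using bij_betw_trans[OF h(2) g(2)] by (simp add: comp_def)
  ultimately show ?thesis
    unfolding pmod_iso_def
    by (intro exI[of _ "\<lambda>a v. g a (h a v)"]) (simp add: h(3) g(3) hN)
qed

lemma pmod_iso_sym:
  assumes M: "is_pmod M" and N: "is_pmod N" and "pmod_iso M N"
  shows "pmod_iso N M"
proof -
  obtain h where h: "\<And>a. linear_on (pspace M a) (pspace N a) (h a)"
      "\<And>a. bij_betw (h a) (pspace M a) (pspace N a)"
      "\<And>a b v. a \<le> b \<Longrightarrow> v \<in> pspace M a \<Longrightarrow> h b (pmap M a b v) = pmap N a b (h a v)"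
    using assms(3) unfolding pmod_iso_def by metis
  define g where "g a = inv_into (pspace M a) (h a)" for a
  have gM: "g a w \<in> pspace M a" and hg: "h a (g a w) = w" if "w \<in> pspace N a" for a w
    using that h(2)[of a] by (auto simp: g_def bij_betw_def inv_into_into f_inv_into_f)
  have gI: "g a w = v" if "v \<in> pspace M a" "h a v = w" for a v w
    using that h(2)[of a] by (auto simp: g_def bij_betw_def)
  have addM: "u + v \<in> pspace M a" if "u \<in> pspace M a" "v \<in> pspace M a" for u v a
    using M that unfolding is_pmod_def fd_space_def by (metis kseq.span_add)
  have scaleM: "sscale c u \<in> pspace M a" if "u \<in> pspace M a" for u c a
    using M that unfolding is_pmod_def fd_space_def by (metis kseq.span_scale)
  have "linear_on (pspace N a) (pspace M a) (g a)" for a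
    using h(1)[of a] unfolding linear_on_def
    by (auto simp: gM hg intro!: gI addM scaleM)
  moreover have "bij_betw (g a) (pspace N a) (pspace M a)" for a
    unfolding g_def by (rule bij_betw_inv_into[OF h(2)])
  moreover have "g b (pmap N a b w) = pmap M a b (g a w)" if "a \<le> b" "w \<in> pspace N a" for a b w
  proof (rule gI)
    show "pmap M a b (g a w) \<in> pspace M b"
      using M that gM[of w a] by (auto simp: is_pmod_def linear_on_def Pi_iff)
    show "h b (pmap M a b (g a w)) = pmap N a b w"
      using that by (simp add: h(3) gM hg)
  qed
  ultimately show ?thesis
    unfolding pmod_iso_def by blast
qed

lemma equiv_pmod_iso_rel: "equiv {M. is_pmod M} pmod_iso_rel"
proof (rule equivI)
  show "pmod_iso_rel \<subseteq> {M. is_pmod M} \<times> {M. is_pmod M}"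
    by (auto simp: pmod_iso_rel_def)
  show "refl_on {M. is_pmod M} pmod_iso_rel"
    by (auto simp: refl_on_def pmod_iso_rel_def pmod_iso_refl)
  show "sym pmod_iso_rel"
    by (auto simp: sym_def pmod_iso_rel_def pmod_iso_sym)
  show "trans pmod_iso_rel"
    unfolding trans_def pmod_iso_rel_def using pmod_iso_trans by blast
qed

lemma isoclass_in_isoclasses: "is_pmod M \<Longrightarrow> isoclass M \<in> isoclasses"
  by (simp add: isoclass_def isoclasses_def quotientI)

lemma isoclass_eq: "is_pmod M \<Longrightarrow> is_pmod N \<Longrightarrow> isoclass M = isoclass N \<longleftrightarrow> pmod_iso M N"
  using eq_equiv_class_iff[OF equiv_pmod_iso_rel]
  by (auto simp: isoclass_def pmod_iso_rel_def)

lemma K0_relations_subset: "K0_relations \<subseteq> carrier (free_Abelian_group isoclasses)"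
proof
  fix x :: "('p::{finite,order}, 'k::field) pmod set \<Rightarrow>\<^sub>0 int"
  assume "x \<in> K0_relations"
  then obtain M N where MN: "is_pmod M" "is_pmod N"
    "x = frag_of (isoclass (M \<oplus>\<^sub>p N)) - (frag_of (isoclass M) + frag_of (isoclass N))"
    by (auto simp: K0_relations_def)
  have "Poly_Mapping.keys x \<subseteq> {isoclass (M \<oplus>\<^sub>p N), isoclass M, isoclass N}"
    unfolding MN(3)
    by (intro order_trans[OF keys_diff] Un_least order_trans[OF keys_add]) (simp_all add: keys_frag_of)
  also have "\<dots> \<subseteq> isoclasses"
    using MN by (auto simp: isoclass_in_isoclasses is_pmod_dsum)
  finally show "x \<in> carrier (free_Abelian_group isoclasses)"
    by simp
qed

lemma K0_subgroup_normal: "K0_subgroup \<lhd> free_Abelian_group isoclasses"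
proof -
  have "subgroup K0_subgroup (free_Abelian_group isoclasses)"
    unfolding K0_subgroup_def
    by (rule group.generate_is_subgroup[OF group_free_Abelian_group K0_relations_subset])
  then show ?thesis
    by (rule comm_group.subgroup_imp_normal[OF abelian_free_Abelian_group])
qed

lemma K0_hom_unique:
  fixes F G :: "(('p::{finite,order}, 'k::field) pmod set \<Rightarrow>\<^sub>0 int) set \<Rightarrow> 'i \<Rightarrow> int"
  assumes F: "F \<in> hom K0sp (Zpow I)" "F \<in> extensional (carrier K0sp)"
    and G: "G \<in> hom K0sp (Zpow I)" "G \<in> extensional (carrier K0sp)"
    and eq: "\<And>M. is_pmod M \<Longrightarrow> F (K0_class M) = G (K0_class M)"
  shows "F = G"
proof (rule extensionalityI[OF F(2) G(2)])
  let ?A = "free_Abelian_group (isoclasses :: ('p, 'k) pmod set set)"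
  let ?q = "\<lambda>c. K0_subgroup #>\<^bsub>?A\<^esub> c"
  have q: "?q \<in> hom ?A K0sp"
    unfolding K0sp_def by (rule normal.r_coset_hom_Mod[OF K0_subgroup_normal])
  have grp: "group (Zpow I)"
    by simp
  have Fq: "group_hom ?A (Zpow I) (F \<circ> ?q)"
    using hom_compose[OF q F(1)] grp by (simp add: group_hom_def group_hom_axioms_def)
  have Gq: "group_hom ?A (Zpow I) (G \<circ> ?q)"
    using hom_compose[OF q G(1)] grp by (simp add: group_hom_def group_hom_axioms_def)
  fix x assume "x \<in> carrier (K0sp :: (('p, 'k) pmod set \<Rightarrow>\<^sub>0 int) set monoid)"
  then obtain c where c: "Poly_Mapping.keys c \<subseteq> isoclasses" "x = ?q c"
    unfolding K0sp_def carrier_FactGroup by (metis carrier_free_Abelian_group_iff imageE)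
  from c(1) have "(F \<circ> ?q) c = (G \<circ> ?q) c"
  proof (rule free_Abelian_group_induct[where P = "\<lambda>c. (F \<circ> ?q) c = (G \<circ> ?q) c"])
    show "(F \<circ> ?q) 0 = (G \<circ> ?q) 0"
      using group_hom.hom_one[OF Fq] group_hom.hom_one[OF Gq]
      by (simp only: one_free_Abelian_group)
  next
    fix a b :: "('p, 'k) pmod set \<Rightarrow>\<^sub>0 int"
    assume keys: "Poly_Mapping.keys a \<subseteq> isoclasses" "Poly_Mapping.keys b \<subseteq> isoclasses"
      and IH: "(F \<circ> ?q) a = (G \<circ> ?q) a" "(F \<circ> ?q) b = (G \<circ> ?q) b"
    have ab: "a - b = a \<otimes>\<^bsub>?A\<^esub> inv\<^bsub>?A\<^esub> b" and "a \<in> carrier ?A" "b \<in> carrier ?A"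
      using keys by simp_all
    moreover have "inv\<^bsub>?A\<^esub> b \<in> carrier ?A"
      using \<open>b \<in> carrier ?A\<close> by (rule group.inv_closed[OF group_free_Abelian_group])
    ultimately show "(F \<circ> ?q) (a - b) = (G \<circ> ?q) (a - b)"
      unfolding ab using IH
      by (simp only: group_hom.hom_mult[OF Fq] group_hom.hom_inv[OF Fq]
          group_hom.hom_mult[OF Gq] group_hom.hom_inv[OF Gq])
  next
    fix C :: "('p, 'k) pmod set"
    assume "C \<in> isoclasses"
    then obtain M where "is_pmod M" "C = isoclass M"
      unfolding isoclasses_def isoclass_def by (metis mem_Collect_eq quotientE)
    then show "(F \<circ> ?q) (frag_of C) = (G \<circ> ?q) (frag_of C)"
      using eq[of M] unfolding K0_class_def comp_apply by (simp only:)
  qed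
  then have "F (?q c) = G (?q c)"
    by (simp only: comp_apply)
  then show "F x = G x"
    by (simp only: \<open>x = ?q c\<close>)
qed

lemma K0_lift_exists:
  fixes \<phi> :: "('p::{finite,order}, 'k::field) pmod \<Rightarrow> 'i \<Rightarrow> int"
  assumes iso: "\<And>M N i. is_pmod M \<Longrightarrow> is_pmod N \<Longrightarrow> pmod_iso M N \<Longrightarrow> i \<in> I \<Longrightarrow> \<phi> M i = \<phi> N i"
    and add: "\<And>M N i. is_pmod M \<Longrightarrow> is_pmod N \<Longrightarrow> i \<in> I \<Longrightarrow> \<phi> (M \<oplus>\<^sub>p N) i = \<phi> M i + \<phi> N i"
  shows "\<exists>F. F \<in> hom K0sp (Zpow I) \<and> F \<in> extensional (carrier K0sp) \<and>
    (\<forall>M. is_pmod M \<longrightarrow> F (K0_class M) = restrict (\<phi> M) I)"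
proof -
  let ?A = "free_Abelian_group (isoclasses :: ('p, 'k) pmod set set)"
  define f where "f C = restrict (\<phi> (SOME M. M \<in> C)) I" for C
  have f: "f (isoclass M) = restrict (\<phi> M) I" if M: "is_pmod M" for M
  proof -
    have "M \<in> isoclass M"
      using M by (simp add: isoclass_def pmod_iso_rel_def pmod_iso_refl)
    then obtain N where N: "(SOME N. N \<in> isoclass M) = N" "N \<in> isoclass M"
      by (metis someI)
    then have "is_pmod N" "pmod_iso M N"
      by (simp_all add: isoclass_def pmod_iso_rel_def)
    then show ?thesis
      unfolding f_def N(1) using M iso by (intro restrict_ext) metis
  qed
  have Z: "comm_group (Zpow I)"
    by (rule group.group_comm_groupI) (auto intro!: restrict_ext)
  have "f ` isoclasses \<subseteq> carrier (Zpow I)"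
    by (auto simp: f_def)
  then obtain h where h: "h \<in> hom ?A (Zpow I)" "\<And>x. x \<in> isoclasses \<Longrightarrow> h (frag_of x) = f x"
    using comm_group.free_Abelian_group_universal[OF Z] by metis
  interpret h: group_hom ?A "Zpow I" h
    using h(1) by (simp add: group_hom_def group_hom_axioms_def)
  have "K0_relations \<subseteq> kernel ?A (Zpow I) h"
  proof
    fix x :: "('p, 'k) pmod set \<Rightarrow>\<^sub>0 int" assume x: "x \<in> K0_relations"
    then obtain M N where MN: "is_pmod M" "is_pmod N"
      "x = frag_of (isoclass (M \<oplus>\<^sub>p N)) - (frag_of (isoclass M) + frag_of (isoclass N))"
      by (auto simp: K0_relations_def)
    let ?s = "frag_of (isoclass (M \<oplus>\<^sub>p N))" and ?m = "frag_of (isoclass M)"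
      and ?n = "frag_of (isoclass N)"
    have carr: "?s \<in> carrier ?A" "?m \<in> carrier ?A" "?n \<in> carrier ?A"
      using MN by (simp_all add: isoclass_in_isoclasses is_pmod_dsum)
    have xeq: "x = ?s \<otimes>\<^bsub>?A\<^esub> inv\<^bsub>?A\<^esub> (?m \<otimes>\<^bsub>?A\<^esub> ?n)"
      using h.G.m_closed[OF carr(2,3)] by (simp add: MN(3))
    have s: "h ?s = h (?m \<otimes>\<^bsub>?A\<^esub> ?n)"
      using MN carr h.hom_mult[OF carr(2,3)]
      by (auto simp: h(2) isoclass_in_isoclasses is_pmod_dsum f add intro!: restrict_ext)
    have "h x = h ?s \<otimes>\<^bsub>Zpow I\<^esub> inv\<^bsub>Zpow I\<^esub> (h (?m \<otimes>\<^bsub>?A\<^esub> ?n))"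
      unfolding xeq using carr h.G.m_closed[OF carr(2,3)]
      by (metis h.hom_mult h.hom_inv h.G.inv_closed)
    also have "\<dots> = \<one>\<^bsub>Zpow I\<^esub>"
      unfolding s by (rule h.H.r_inv[OF h.hom_closed[OF h.G.m_closed[OF carr(2,3)]]])
    finally show "x \<in> kernel ?A (Zpow I) h"
      using subsetD[OF K0_relations_subset x] by (simp only: kernel_def mem_Collect_eq)
  qed
  then have "K0_subgroup \<subseteq> kernel ?A (Zpow I) h"
    unfolding K0_subgroup_def
    by (rule h.G.generate_subgroup_incl[OF _ h.subgroup_kernel])
  then obtain g where g: "g \<in> hom (?A Mod K0_subgroup) (Zpow I)"
      "\<And>x. x \<in> carrier ?A \<Longrightarrow> g (K0_subgroup #>\<^bsub>?A\<^esub> x) = h x"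
    using h.FactGroup_universal_kernel[OF K0_subgroup_normal] by metis
  interpret Q: group "?A Mod K0_subgroup"
    by (rule normal.factorgroup_is_group[OF K0_subgroup_normal])
  let ?F = "restrict g (carrier K0sp)"
  have "?F \<in> hom K0sp (Zpow I)"
    unfolding K0sp_def by (rule Q.hom_restrict[OF g(1)]) simp
  moreover have "?F (K0_class M) = restrict (\<phi> M) I" if "is_pmod M" for M
  proof -
    have "frag_of (isoclass M) \<in> carrier ?A"
      using that by (simp add: isoclass_in_isoclasses)
    then have "K0_class M \<in> carrier K0sp" "g (K0_class M) = h (frag_of (isoclass M))"
      unfolding K0sp_def K0_class_def carrier_FactGroup by (blast, rule g(2))
    then show ?thesis
      using that by (simp add: h(2) isoclass_in_isoclasses f)
  qed
  ultimately show ?thesis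
    by blast
qed

lemma
  fixes \<phi> :: "('p::{finite,order}, 'k::field) pmod \<Rightarrow> 'i \<Rightarrow> int"
  assumes iso: "\<And>M N i. is_pmod M \<Longrightarrow> is_pmod N \<Longrightarrow> pmod_iso M N \<Longrightarrow> i \<in> I \<Longrightarrow> \<phi> M i = \<phi> N i"
    and add: "\<And>M N i. is_pmod M \<Longrightarrow> is_pmod N \<Longrightarrow> i \<in> I \<Longrightarrow> \<phi> (M \<oplus>\<^sub>p N) i = \<phi> M i + \<phi> N i"
  shows K0_lift_hom: "K0_lift I \<phi> \<in> hom K0sp (Zpow I)"
    and K0_lift_class: "is_pmod M \<Longrightarrow> K0_lift I \<phi> (K0_class M) = restrict (\<phi> M) I"
proof -
  let ?P = "\<lambda>F. F \<in> hom K0sp (Zpow I) \<and> F \<in> extensional (carrier K0sp) \<and>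
    (\<forall>M. is_pmod M \<longrightarrow> F (K0_class M) = restrict (\<phi> M) I)"
  have "\<exists>!F. ?P F"
  proof (rule ex_ex1I)
    show "\<exists>F. ?P F"
      by (rule K0_lift_exists[OF assms])
  next
    fix F G assume "?P F" "?P G"
    then show "F = G"
      using K0_hom_unique[of F I G] by simp
  qed
  from theI'[OF this] have "?P (K0_lift I \<phi>)"
    unfolding K0_lift_def .
  then show "K0_lift I \<phi> \<in> hom K0sp (Zpow I)"
    and "is_pmod M \<Longrightarrow> K0_lift I \<phi> (K0_class M) = restrict (\<phi> M) I"
    by auto
qed


section \<open>The rank invariant\<close>

definition leq_pairs :: "('p::{finite,order} \<times> 'p) set"
  where "leq_pairs = {(a, b). a \<le> b}"

definition rk_inv ::
  "(('p::{finite,order}, 'k::field) pmod set \<Rightarrow>\<^sub>0 int) set \<Rightarrow> 'p \<times> 'p \<Rightarrow> int"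
  where "rk_inv = K0_lift leq_pairs (\<lambda>M (a, b). int (kseq.dim (pmap M a b ` pspace M a)))"


section \<open>Multiplicity invariants\<close>

definition order_embedding :: "('x::order \<Rightarrow> 'p::order) \<Rightarrow> bool"
  where "order_embedding f \<longleftrightarrow> (\<forall>x y. x \<le> y \<longleftrightarrow> f x \<le> f y)"

definition order_automorphism :: "('x::order \<Rightarrow> 'x) \<Rightarrow> bool"
  where "order_automorphism \<sigma> \<longleftrightarrow> bij \<sigma> \<and> order_embedding \<sigma>"

definition Emb :: "('x::{finite,order} \<Rightarrow> 'p::{finite,order}) set set"
  where "Emb = {f. order_embedding f} //
    {(f, g). order_embedding f \<and> order_embedding g \<and>
             (\<exists>\<sigma>. order_automorphism \<sigma> \<and> g = f \<circ> \<sigma>)}"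

definition pullback ::
  "('x \<Rightarrow> 'p) \<Rightarrow> ('p::{finite,order}, 'k::field) pmod \<Rightarrow> ('x::{finite,order}, 'k) pmod"
  where "pullback f M =
    \<lparr>pspace = (\<lambda>x. pspace M (f x)), pmap = (\<lambda>x y. pmap M (f x) (f y))\<rparr>"

text \<open>
  Here \<open>S\<close> is a set of representatives of the indecomposables over the poset \<open>'x\<close>. An element of
  \<open>Emb\<close> is a class of embeddings modulo automorphisms of \<open>'x\<close>, at which the invariant is evaluated
  through a chosen representative; if \<open>'x\<close> has no nontrivial automorphism, every class is a
  singleton and there is no choice.
\<close>

definition mult_index ::
  "('x::{finite,order}, 'k::field) pmod set
    \<Rightarrow> (('x \<Rightarrow> 'p::{finite,order}) set \<times> ('x, 'k) pmod) set"
  where "mult_index S = Emb \<times> S"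

definition mult_inv ::
  "('x::{finite,order}, 'k::field) pmod set \<Rightarrow> (('p::{finite,order}, 'k) pmod set \<Rightarrow>\<^sub>0 int) set
    \<Rightarrow> ('x \<Rightarrow> 'p) set \<times> ('x, 'k) pmod \<Rightarrow> int"
  where "mult_inv S = K0_lift (mult_index S)
    (\<lambda>M (c, U). int (multiplicity U (pullback (SOME f. f \<in> c) M)))"


section \<open>Particular posets\<close>

text \<open>The two-element chain: \<open>bool\<close> is ordered by \<open>False < True\<close>.\<close>

type_synonym X2 = bool

definition connected_poset :: "'p::order itself \<Rightarrow> bool"
  where "connected_poset _ \<longleftrightarrow> (\<forall>a b :: 'p. (\<lambda>x y. x \<le> y \<or> y \<le> x)\<^sup>*\<^sup>* a b)"

end

theory Submission
  imports Defs "HOL-Library.Product_Plus"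
begin

text \<open>
  Restricting a module \<open>M\<close> along an embedding of the two-element chain with image \<open>a < b\<close> gives the
  single linear map from \<open>M a\<close> to \<open>M b\<close>. In bases adapted to it, such a map is a direct sum of copies
  of \<open>k \<rightarrow> 0\<close>, \<open>0 \<rightarrow> k\<close> and the identity \<open>k \<rightarrow> k\<close>, with multiplicities
  \<open>dim (M a) - rk\<close>, \<open>dim (M b) - rk\<close> and \<open>rk\<close>, where \<open>rk\<close> is its rank. Dimensions are ranks of
  identity maps, so the multiplicity invariant is a fixed integer-linear function \<open>T\<close> of the rank
  invariant (\<open>multiplicity_eq_mult_of_rk\<close>). Conversely \<open>T\<close> is injective
  (\<open>mult_of_rk_inj\<close>): the rank at \<open>a < b\<close> is one of the multiplicities, and the dimension at \<open>a\<close> is a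
  sum of two multiplicities at any pair of comparable distinct points containing \<open>a\<close>. Such a pair
  exists because the poset is connected and has a second point. Hence \<open>T\<close> restricts to an
  isomorphism between the images of the two invariants (\<open>equivalent_K0_lifts\<close>).

  Multiplicities are defined through complements of powers of a module and not through a
  decomposition into indecomposables. To compute them, the three numbers above are collected in the
  \<open>chain_type\<close>. It is additive, separates isomorphism classes and takes every value
  (\<open>chain_type_dsum\<close>, \<open>chain_iso_iff\<close>, \<open>ex_chain_type\<close>), so the monoid of isomorphism
  classes of modules over the two-element chain is \<open>\<nat>\<^sup>3\<close> under addition. Therefore the indecomposables
  are the modules whose type is a unit vector, and multiplicities are coordinates.
\<close>

section \<open>Finite-dimensional spaces of sequences\<close>

global_interpretation kpair: vector_space_pair
  "sscale :: 'k::field \<Rightarrow> (nat \<Rightarrow> 'k) \<Rightarrow> nat \<Rightarrow> 'k" "sscale :: 'k \<Rightarrow> (nat \<Rightarrow> 'k) \<Rightarrow> nat \<Rightarrow> 'k"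
  by unfold_locales

abbreviation klinear :: "((nat \<Rightarrow> 'k::field) \<Rightarrow> nat \<Rightarrow> 'k) \<Rightarrow> bool"
  where "klinear \<equiv> Vector_Spaces.linear sscale sscale"

lemma klinearI:
  assumes "\<And>u v. g (u + v) = g u + g v" "\<And>c v. g (sscale c v) = sscale c (g v)"
  shows "klinear g"
  by (rule Vector_Spaces.linear_iff[THEN iffD2]) (simp add: assms kseq.vector_space_axioms)

lemma fd_space_subspace: "fd_space V \<Longrightarrow> kseq.subspace V"
  by (auto simp: fd_space_def)

lemma fd_space_extend_basis:
  assumes V: "fd_space V" and A: "A \<subseteq> V" "kseq.independent A"
  obtains B where "A \<subseteq> B" "finite B" "kseq.independent B" "kseq.span B = V" "kseq.dim V = card B"
proof -
  obtain B where B: "A \<subseteq> B" "B \<subseteq> V" "kseq.independent B" "V \<subseteq> kseq.span B"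
    using kseq.maximal_independent_subset_extend[OF A] by blast
  obtain G where "finite G" "V = kseq.span G"
    using V by (auto simp: fd_space_def)
  then have "finite B"
    using kseq.independent_span_bound[of G B] B by blast
  moreover have "kseq.span B = V"
    using B kseq.span_minimal[OF B(2) fd_space_subspace[OF V]] by blast
  ultimately show thesis
    using that B kseq.dim_eq_card_independent by (metis kseq.dim_span)
qed

lemma fd_space_basis:
  assumes "fd_space V"
  obtains B where "finite B" "kseq.independent B" "kseq.span B = V" "kseq.dim V = card B"
  using fd_space_extend_basis[OF assms, of "{}"] kseq.independent_empty by (metis empty_subsetI)

text \<open>
  Structure maps and module isomorphisms are linear on their domain only. Extending them to the
  whole sequence space makes the theory of globally linear maps applicable.
\<close>

lemma linear_on_extend:
  assumes h: "linear_on V W h" and V: "fd_space V"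
  obtains g where "klinear g" "\<And>v. v \<in> V \<Longrightarrow> g v = h v"
proof -
  obtain B where B: "finite B" "kseq.independent B" "kseq.span B = V"
    using fd_space_basis[OF V] by metis
  define g where "g = kpair.construct B h"
  have g: "klinear g"
    unfolding g_def by (rule kpair.linear_construct[OF B(2)])
  have sub: "kseq.subspace V"
    by (rule fd_space_subspace[OF V])
  have h0: "h 0 = 0"
  proof -
    have "h (sscale 0 0) = sscale 0 (h 0)"
      using h kseq.subspace_0[OF sub] unfolding linear_on_def by blast
    then show ?thesis
      by simp
  qed
  have "v \<in> V \<and> g v = h v" if "v \<in> kseq.span B" for v
    using that
  proof (induction rule: kseq.span_induct_alt)
    case base
    then show ?case
      using h0 kpair.linear_0[OF g] kseq.subspace_0[OF sub] by metis
  next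
    case (step c x y)
    have x: "x \<in> V" "g x = h x"
      using step B kseq.span_superset[of B] kpair.construct_basis[OF B(2)] by (auto simp: g_def)
    have cx: "sscale c x \<in> V"
      by (rule kseq.subspace_scale[OF sub x(1)])
    have "h (sscale c x + y) = h (sscale c x) + h y" "h (sscale c x) = sscale c (h x)"
      using h cx x step unfolding linear_on_def by blast+
    moreover have "g (sscale c x + y) = sscale c (g x) + g y"
      by (simp only: kpair.linear_add[OF g] kpair.linear_scale[OF g])
    ultimately show ?case
      using x step kseq.subspace_add[OF sub cx] by metis
  qed
  then show thesis
    using that g B(3) by blast
qed

lemma fd_space_image:
  assumes "linear_on V W h" "fd_space V"
  shows "fd_space (h ` V)"
proof -
  obtain g where g: "klinear g" "\<And>v. v \<in> V \<Longrightarrow> g v = h v"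
    using linear_on_extend[OF assms] by metis
  obtain B where B: "finite B" "kseq.span B = V"
    using fd_space_basis[OF assms(2)] by metis
  have "h ` V = kseq.span (g ` B)"
    using g B by (simp add: kpair.linear_span_image cong: image_cong_simp)
  then show ?thesis
    using B unfolding fd_space_def by blast
qed

lemma dim_image_inj_on:
  assumes h: "linear_on V W h" and V: "fd_space V" and inj: "inj_on h V"
    and U: "fd_space U" "U \<subseteq> V"
  shows "kseq.dim (h ` U) = kseq.dim U"
proof -
  obtain g where g: "klinear g" "\<And>v. v \<in> V \<Longrightarrow> g v = h v"
    using linear_on_extend[OF h V] by metis
  obtain B where B: "finite B" "kseq.independent B" "kseq.span B = U" "kseq.dim U = card B"
    using fd_space_basis[OF U(1)] by metis
  have hU: "h ` U = kseq.span (g ` B)"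
    using g B U by (simp add: kpair.linear_span_image subset_eq cong: image_cong_simp)
  have injg: "inj_on g (kseq.span B)"
    using inj U g B(3) by (metis inj_on_cong inj_on_subset subset_iff)
  then have "kseq.independent (g ` B)"
    using kpair.linear_independent_injective_image[OF g(1) B(2)] by blast
  then have "kseq.dim (h ` U) = card (g ` B)"
    unfolding hU by (simp add: kseq.dim_eq_card_independent)
  also have "\<dots> = card B"
    using injg kseq.span_superset by (intro card_image) (rule inj_on_subset)
  finally show ?thesis
    using B by simp
qed

lemma dim_interleave:
  assumes "fd_space V" "fd_space W"
  shows "kseq.dim {interleave u v |u v. u \<in> V \<and> v \<in> W} = kseq.dim V + kseq.dim W"
proof -
  obtain B where B: "finite B" "kseq.independent B" "kseq.span B = V" "kseq.dim V = card B"
    using fd_space_basis[OF assms(1)] by metis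
  obtain C where C: "finite C" "kseq.independent C" "kseq.span C = W" "kseq.dim W = card C"
    using fd_space_basis[OF assms(2)] by metis
  \<comment> \<open>The images of the two bases under the coordinate inclusions form a basis.\<close>
  let ?L = "\<lambda>u :: nat \<Rightarrow> 'a. interleave u 0" and ?R = "\<lambda>v :: nat \<Rightarrow> 'a. interleave 0 v"
  have L: "klinear ?L" and R: "klinear ?R"
    by (intro klinearI; simp flip: interleave_add interleave_scale)+
  have span: "kseq.span (?L ` X \<union> ?R ` Y)
      = {interleave u v |u v. u \<in> kseq.span X \<and> v \<in> kseq.span Y}" for X Y
  proof -
    have split: "interleave u v = ?L u + ?R v" for u v
      by (simp flip: interleave_add)
    have "kseq.span (?L ` X \<union> ?R ` Y)
        = {x + y |x y. x \<in> ?L ` kseq.span X \<and> y \<in> ?R ` kseq.span Y}"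
      by (simp only: kseq.span_Un kpair.linear_span_image[OF L] kpair.linear_span_image[OF R])
    also have "\<dots> = {interleave u v |u v. u \<in> kseq.span X \<and> v \<in> kseq.span Y}"
      by (subst (3) split) blast
    finally show ?thesis .
  qed
  have inj: "inj ?L" "inj ?R"
    by (metis injI evens_interleave, metis injI odds_interleave)
  have disj: "?L ` B \<inter> ?R ` C = {}"
  proof -
    have "0 \<notin> B"
      using B(2) kseq.dependent_zero by blast
    moreover have "u = 0" if "?L u = ?R v" for u v :: "nat \<Rightarrow> 'a"
      using that by (metis evens_interleave)
    ultimately show ?thesis
      by blast
  qed
  have "kseq.independent (?L ` B \<union> ?R ` C)"
  proof
    assume "kseq.dependent (?L ` B \<union> ?R ` C)"
    then obtain a where a: "a \<in> ?L ` B \<union> ?R ` C" "a \<in> kseq.span (?L ` B \<union> ?R ` C - {a})"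
      unfolding kseq.dependent_def by blast
    from a(1) show False
    proof
      assume "a \<in> ?L ` B"
      then obtain b where b: "b \<in> B" "a = ?L b"
        by blast
      have "?L ` B \<union> ?R ` C - {a} \<subseteq> ?L ` (B - {b}) \<union> ?R ` C"
        using b by auto
      then have "?L b \<in> kseq.span (?L ` (B - {b}) \<union> ?R ` C)"
        using a(2) b kseq.span_mono by blast
      then have "b \<in> kseq.span (B - {b})"
        unfolding span by (auto dest: arg_cong[of _ _ evens])
      then show False
        using B(2) b by (auto simp: kseq.dependent_def)
    next
      assume "a \<in> ?R ` C"
      then obtain c where c: "c \<in> C" "a = ?R c"
        by blast
      have "?L ` B \<union> ?R ` C - {a} \<subseteq> ?L ` B \<union> ?R ` (C - {c})"
        using c by auto
      then have "?R c \<in> kseq.span (?L ` B \<union> ?R ` (C - {c}))"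
        using a(2) c kseq.span_mono by blast
      then have "c \<in> kseq.span (C - {c})"
        unfolding span by (auto dest: arg_cong[of _ _ odds])
      then show False
        using C(2) c by (auto simp: kseq.dependent_def)
    qed
  qed
  then have "kseq.dim {interleave u v |u v. u \<in> V \<and> v \<in> W} = card (?L ` B \<union> ?R ` C)"
    by (simp flip: B(3) C(3) span add: kseq.dim_eq_card_independent)
  also have "\<dots> = card B + card C"
    using B C inj disj by (simp add: card_Un_disjoint card_image inj_on_subset)
  finally show ?thesis
    using B C by simp
qed


section \<open>Ranks of structure maps\<close>

definition mrank :: "('p::{finite,order}, 'k::field) pmod \<Rightarrow> 'p \<Rightarrow> 'p \<Rightarrow> nat"
  where "mrank M a b = kseq.dim (pmap M a b ` pspace M a)"

lemma is_pmodD: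
  assumes "is_pmod M"
  shows "fd_space (pspace M a)"
    and "a \<le> b \<Longrightarrow> linear_on (pspace M a) (pspace M b) (pmap M a b)"
    and "v \<in> pspace M a \<Longrightarrow> pmap M a a v = v"
  using assms by (auto simp: is_pmod_def)

lemma mrank_iso:
  assumes M: "is_pmod M" and N: "is_pmod N" and "pmod_iso M N" and "a \<le> b"
  shows "mrank M a b = mrank N a b"
proof -
  obtain h where h: "\<And>a. linear_on (pspace M a) (pspace N a) (h a)"
      "\<And>a. bij_betw (h a) (pspace M a) (pspace N a)"
      "\<And>a b v. a \<le> b \<Longrightarrow> v \<in> pspace M a \<Longrightarrow> h b (pmap M a b v) = pmap N a b (h a v)"
    using assms(3) unfolding pmod_iso_def by metis
  note lin = is_pmodD(2)[OF M \<open>a \<le> b\<close>]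
  have "pmap N a b ` pspace N a = h b ` (pmap M a b ` pspace M a)"
    using h(3)[OF \<open>a \<le> b\<close>] bij_betw_imp_surj_on[OF h(2)[of a], symmetric]
    by (simp add: image_image cong: image_cong_simp)
  moreover have "pmap M a b ` pspace M a \<subseteq> pspace M b"
    using lin by (auto simp: linear_on_def)
  ultimately show ?thesis
    unfolding mrank_def
    using dim_image_inj_on[OF h(1) is_pmodD(1)[OF M] bij_betw_imp_inj_on[OF h(2)]
        fd_space_image[OF lin is_pmodD(1)[OF M]]]
    by simp
qed

lemma mrank_dsum:
  assumes "is_pmod M" "is_pmod N" "a \<le> b"
  shows "mrank (M \<oplus>\<^sub>p N) a b = mrank M a b + mrank N a b"
proof -
  have "pmap (M \<oplus>\<^sub>p N) a b ` pspace (M \<oplus>\<^sub>p N) a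
      = {interleave u v |u v. u \<in> pmap M a b ` pspace M a \<and> v \<in> pmap N a b ` pspace N a}"
    by (force simp: dsum_def image_iff)
  moreover have "fd_space (pmap M a b ` pspace M a)" "fd_space (pmap N a b ` pspace N a)"
    using assms by (auto intro: fd_space_image is_pmodD)
  ultimately show ?thesis
    unfolding mrank_def by (simp only: dim_interleave)
qed

lemma is_pmod_zero: "is_pmod (zero_pmod :: ('p::{finite,order}, 'k::field) pmod)"
proof -
  have "fd_space {0 :: nat \<Rightarrow> 'k}"
    unfolding fd_space_def by (metis finite.emptyI kseq.span_empty)
  then show ?thesis
    by (auto simp: is_pmod_def zero_pmod_def linear_on_def)
qed

lemma mrank_zero: "mrank zero_pmod a b = 0"
  using kseq.dim_span_eq_card_independent[OF kseq.independent_empty]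
  by (simp add: mrank_def zero_pmod_def)

lemma is_pmod_dpower: "is_pmod U \<Longrightarrow> is_pmod (dpower n U)"
  by (induction n) (simp_all add: is_pmod_zero is_pmod_dsum)

lemma is_pmod_pullback: "is_pmod M \<Longrightarrow> order_embedding f \<Longrightarrow> is_pmod (pullback f M)"
  by (simp add: is_pmod_def pullback_def order_embedding_def)

lemma mrank_pullback: "mrank (pullback f M) x y = mrank M (f x) (f y)"
  by (simp add: mrank_def pullback_def)


section \<open>Coordinates\<close>

definition coord_space :: "nat \<Rightarrow> (nat \<Rightarrow> 'k::field) set"
  where "coord_space n = {c. \<forall>i\<ge>n. c i = 0}"

definition lincomb :: "(nat \<Rightarrow> 'k::field) list \<Rightarrow> (nat \<Rightarrow> 'k) \<Rightarrow> nat \<Rightarrow> 'k"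
  where "lincomb bs c = (\<Sum>i<length bs. sscale (c i) (bs ! i))"

definition basis_list :: "(nat \<Rightarrow> 'k::field) list \<Rightarrow> (nat \<Rightarrow> 'k) set \<Rightarrow> bool"
  where "basis_list bs V \<longleftrightarrow> distinct bs \<and> kseq.independent (set bs) \<and> kseq.span (set bs) = V"

lemma lincomb_eq_sum_set:
  assumes "distinct bs" "\<And>i. i < length bs \<Longrightarrow> c i = u (bs ! i)"
  shows "lincomb bs c = (\<Sum>b\<in>set bs. sscale (u b) b)"
proof -
  have "(\<Sum>b\<in>set bs. sscale (u b) b) = (\<Sum>i<length bs. sscale (u (bs ! i)) (bs ! i))"
    by (rule sum.reindex_bij_betw[OF bij_betw_nth[OF assms(1) refl refl], symmetric])
  then show ?thesis
    using assms(2) by (simp add: lincomb_def)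
qed

lemma lincomb_add: "lincomb bs (c + d) = lincomb bs c + lincomb bs d"
  by (simp add: lincomb_def kseq.scale_left_distrib sum.distrib)

lemma lincomb_scale: "lincomb bs (sscale a c) = sscale a (lincomb bs c)"
  by (simp add: lincomb_def kseq.scale_sum_right) (simp add: sscale_def mult.assoc)

lemma lincomb_in_span: "lincomb bs c \<in> kseq.span (set bs)"
  unfolding lincomb_def by (intro kseq.span_sum kseq.span_scale kseq.span_base) simp

lemma linear_on_lincomb:
  assumes "basis_list bs V"
  shows "linear_on (coord_space (length bs)) V (lincomb bs)"
  using assms lincomb_in_span[of bs]
  by (auto simp: linear_on_def basis_list_def lincomb_add lincomb_scale simp del: plus_fun_apply)

lemma bij_betw_lincomb:
  assumes "basis_list bs V"
  shows "bij_betw (lincomb bs) (coord_space (length bs)) V"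
proof -
  note bs = assms[unfolded basis_list_def]
  define pos where "pos = inv_into {..<length bs} ((!) bs)"
  have pos: "pos (bs ! i) = i" if "i < length bs" for i
    using that bs by (simp add: pos_def inj_on_nth)
  have "inj_on (lincomb bs) (coord_space (length bs))"
  proof (rule inj_onI)
    fix c d :: "nat \<Rightarrow> 'a"
    assume cd: "c \<in> coord_space (length bs)" "d \<in> coord_space (length bs)"
      and eq: "lincomb bs c = lincomb bs d"
    have "(\<Sum>b\<in>set bs. sscale (c (pos b) - d (pos b)) b)
        = (\<Sum>b\<in>set bs. sscale (c (pos b)) b) - (\<Sum>b\<in>set bs. sscale (d (pos b)) b)"
      by (simp only: kseq.scale_left_diff_distrib sum_subtractf)
    also have "\<dots> = lincomb bs c - lincomb bs d"
      using bs lincomb_eq_sum_set[of bs c "\<lambda>b. c (pos b)"] lincomb_eq_sum_set[of bs d "\<lambda>b. d (pos b)"]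
      by (simp add: pos)
    finally have sum0: "(\<Sum>b\<in>set bs. sscale (c (pos b) - d (pos b)) b) = 0"
      using eq by simp
    have "c (pos b) - d (pos b) = 0" if "b \<in> set bs" for b
      using kseq.independentD[OF _ _ _ sum0 that, of "set bs"] bs by simp
    then have "c i = d i" if "i < length bs" for i
      using that pos[of i] nth_mem[of i bs] eq_iff_diff_eq_0 by metis
    moreover have "c i = d i" if "\<not> i < length bs" for i
      using cd that by (simp add: coord_space_def)
    ultimately show "c = d"
      by (intro ext) blast
  qed
  moreover have "lincomb bs ` coord_space (length bs) = V"
  proof
    show "lincomb bs ` coord_space (length bs) \<subseteq> V"
      using lincomb_in_span[of bs] bs by auto
    show "V \<subseteq> lincomb bs ` coord_space (length bs)"
    proof
      fix x assume "x \<in> V"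
      then obtain u where u: "x = (\<Sum>b\<in>set bs. sscale (u b) b)"
        using bs kseq.span_finite[of "set bs"] by auto
      let ?c = "\<lambda>i. if i < length bs then u (bs ! i) else 0"
      have "lincomb bs ?c = x"
        unfolding u using bs by (intro lincomb_eq_sum_set) auto
      moreover have "?c \<in> coord_space (length bs)"
        by (simp add: coord_space_def)
      ultimately show "x \<in> lincomb bs ` coord_space (length bs)"
        by blast
    qed
  qed
  ultimately show ?thesis
    by (simp add: bij_betw_def)
qed

definition unit_vectors :: "nat \<Rightarrow> (nat \<Rightarrow> 'k::field) list"
  where "unit_vectors n = map (\<lambda>i j. if j = i then 1 else 0) [0..<n]"

lemma length_unit_vectors: "length (unit_vectors n) = n"
  by (simp add: unit_vectors_def)

lemma sum_fun_apply: "(\<Sum>i\<in>A. f i) x = (\<Sum>i\<in>A. f i x :: 'k::comm_monoid_add)"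
  by (induction A rule: infinite_finite_induct) simp_all

lemma lincomb_unit_vectors: "lincomb (unit_vectors n) c = (\<lambda>i. if i < n then c i else 0)"
proof
  fix j
  have "lincomb (unit_vectors n) c j = (\<Sum>i<n. sscale (c i) (unit_vectors n ! i) j)"
    unfolding lincomb_def sum_fun_apply length_unit_vectors ..
  also have "\<dots> = (\<Sum>i<n. if i = j then c i else 0)"
    by (rule sum.cong) (auto simp: unit_vectors_def sscale_def)
  also have "\<dots> = (if j < n then c j else 0)"
    by simp
  finally show "lincomb (unit_vectors n) c j = (if j < n then c j else 0)" .
qed

lemma subspace_coord_space: "kseq.subspace (coord_space n)"
  by (auto simp: coord_space_def kseq.subspace_def sscale_def)

lemma basis_list_unit_vectors: "basis_list (unit_vectors n) (coord_space n :: (nat \<Rightarrow> 'k::field) set)"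
proof -
  let ?e = "unit_vectors n :: (nat \<Rightarrow> 'k) list"
  have "inj_on (\<lambda>i j. if j = i then 1 else 0 :: 'k) {0..<n}"
    by (rule inj_onI) (metis zero_neq_one)
  then have dist: "distinct ?e"
    by (simp add: unit_vectors_def distinct_map)
  have "kseq.independent (set ?e)"
  proof (rule kseq.independent_if_scalars_zero)
    fix u and x :: "nat \<Rightarrow> 'k"
    assume 0: "(\<Sum>x\<in>set ?e. sscale (u x) x) = 0" and "x \<in> set ?e"
    then obtain i where i: "i < n" "x = ?e ! i"
      by (metis in_set_conv_nth length_unit_vectors)
    have "lincomb ?e (\<lambda>i. u (?e ! i)) = 0"
      using lincomb_eq_sum_set[OF dist, of "\<lambda>i. u (?e ! i)" u] 0 by simp
    from fun_cong[OF this, of i] show "u x = 0"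
      using i by (simp add: lincomb_unit_vectors)
  qed simp
  moreover have "kseq.span (set ?e) = coord_space n"
  proof
    show "kseq.span (set ?e) \<subseteq> coord_space n"
      by (rule kseq.span_minimal[OF _ subspace_coord_space])
        (auto simp: unit_vectors_def coord_space_def)
  next
    show "coord_space n \<subseteq> kseq.span (set ?e)"
    proof
      fix c :: "nat \<Rightarrow> 'k" assume "c \<in> coord_space n"
      then have "lincomb ?e c = c"
        unfolding lincomb_unit_vectors by (auto simp: coord_space_def fun_eq_iff)
      then show "c \<in> kseq.span (set ?e)"
        by (metis lincomb_in_span)
    qed
  qed
  ultimately show ?thesis
    using dist by (simp add: basis_list_def)
qed

lemma fd_coord_space: "fd_space (coord_space n)"
  using basis_list_unit_vectors[of n] unfolding basis_list_def fd_space_def by (metis finite_set)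

lemma dim_coord_space: "kseq.dim (coord_space n :: (nat \<Rightarrow> 'k::field) set) = n"
  using basis_list_unit_vectors[where n = n and 'k = 'k]
    kseq.dim_span_eq_card_independent[of "set (unit_vectors n :: (nat \<Rightarrow> 'k) list)"]
  by (auto simp: basis_list_def distinct_card length_unit_vectors)

text \<open>
  Rank-nullity in the form of bases adapted to a linear map \<open>f\<close>: complete a basis \<open>ys\<close> of the kernel
  to a basis of \<open>V\<close>. Then \<open>f\<close> is injective on the span of the new vectors \<open>xs\<close>, so their images are
  independent and can be completed to a basis of \<open>W\<close>.
\<close>

lemma adapted_bases:
  assumes V: "fd_space V" and W: "fd_space W" and f: "linear_on V W f"
  obtains xs ys zs where "basis_list (xs @ ys) V" "basis_list (map f xs @ zs) W"
    "\<And>y. y \<in> set ys \<Longrightarrow> f y = 0"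
proof -
  obtain g where g: "klinear g" "\<And>v. v \<in> V \<Longrightarrow> g v = f v"
    using linear_on_extend[OF f V] by metis
  obtain K where K: "K \<subseteq> {v \<in> V. g v = 0}" "kseq.independent K" "{v \<in> V. g v = 0} \<subseteq> kseq.span K"
    using kseq.maximal_independent_subset[of "{v \<in> V. g v = 0}"] by blast
  obtain B where B: "K \<subseteq> B" "finite B" "kseq.independent B" "kseq.span B = V"
    using fd_space_extend_basis[OF V _ K(2)] K(1) by blast
  \<comment> \<open>A kernel vector in the span of \<open>B - K\<close> also lies in the span of \<open>K\<close>, so its coordinates
    with respect to \<open>B\<close> are supported on both \<open>B - K\<close> and \<open>K\<close>.\<close>
  have "x = 0" if x: "x \<in> kseq.span (B - K)" "g x = 0" for x
  proof -
    have "x \<in> V"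
      using x(1) B(4) kseq.span_mono[of "B - K" B] by blast
    then have "x \<in> kseq.span K"
      using K(3) x(2) by blast
    then have "kseq.representation B x = kseq.representation K x"
      using kseq.representation_extend[OF B(3)] B(1) by blast
    moreover have "kseq.representation B x = kseq.representation (B - K) x"
      using kseq.representation_extend[OF B(3) x(1)] by blast
    ultimately have "kseq.representation B x b = 0" for b
      using kseq.representation_ne_zero[of K x b] kseq.representation_ne_zero[of "B - K" x b] by auto
    then show ?thesis
      using kseq.sum_nonzero_representation_eq[OF B(3), of x] \<open>x \<in> V\<close> B(4) by simp
  qed
  then have inj: "inj_on g (kseq.span (B - K))"
    using kpair.linear_inj_on_iff_eq_0[OF g(1) kseq.subspace_span] by blast
  have "kseq.independent (B - K)"
    using B(3) kseq.independent_mono by blast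
  then have ind: "kseq.independent (g ` (B - K))"
    using kpair.linear_independent_injective_image[OF g(1) _ inj] by blast
  have BV: "B \<subseteq> V"
    using B(4) kseq.span_superset by blast
  then have "g ` (B - K) \<subseteq> W"
    using f g(2) by (auto simp: linear_on_def subset_eq Pi_iff)
  then obtain D where D: "g ` (B - K) \<subseteq> D" "finite D" "kseq.independent D" "kseq.span D = W"
    using fd_space_extend_basis[OF W _ ind] by blast
  obtain xs where xs: "set xs = B - K" "distinct xs"
    using finite_distinct_list[of "B - K"] B(2) by auto
  obtain ys where ys: "set ys = K" "distinct ys"
    using finite_distinct_list[of K] B(1,2) finite_subset by metis
  obtain zs where zs: "set zs = D - g ` (B - K)" "distinct zs"
    using finite_distinct_list[of "D - g ` (B - K)"] D(2) by auto
  have map_eq: "map f xs = map g xs"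
    using xs(1) BV g(2) by auto
  have "inj_on g (B - K)"
    using inj kseq.span_superset by (rule inj_on_subset)
  then have "basis_list (map f xs @ zs) W"
    unfolding map_eq using xs zs D by (auto simp: basis_list_def distinct_map Un_absorb1)
  moreover have "basis_list (xs @ ys) V"
    using xs ys B by (auto simp: basis_list_def Un_absorb2)
  moreover have "f y = 0" if "y \<in> set ys" for y
    using that ys K(1) g(2) by force
  ultimately show thesis
    using that by blast
qed


section \<open>Classification of modules over the two-element chain\<close>

definition cutoff :: "nat \<Rightarrow> (nat \<Rightarrow> 'k::field) \<Rightarrow> nat \<Rightarrow> 'k"
  where "cutoff r c = (\<lambda>i. if i < r then c i else 0)"

text \<open>
  The direct sum of \<open>p\<close> copies of \<open>k \<rightarrow> 0\<close>, \<open>q\<close> copies of \<open>0 \<rightarrow> k\<close> and \<open>r\<close> copies of the identity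
  \<open>k \<rightarrow> k\<close>; the latter occupy the first \<open>r\<close> coordinates.
\<close>

definition std_chain :: "nat \<Rightarrow> nat \<Rightarrow> nat \<Rightarrow> (X2, 'k::field) pmod"
  where "std_chain p q r =
    \<lparr>pspace = (\<lambda>x. coord_space (if x then r + q else r + p)),
     pmap = (\<lambda>x y. if x = y then id else cutoff r)\<rparr>"

text \<open>The multiplicities of \<open>k \<rightarrow> 0\<close>, of \<open>0 \<rightarrow> k\<close> and of \<open>k \<rightarrow> k\<close>.\<close>

definition chain_type :: "(X2, 'k::field) pmod \<Rightarrow> nat \<times> nat \<times> nat"
  where "chain_type M =
    (mrank M False False - mrank M False True, mrank M True True - mrank M False True,
     mrank M False True)"

lemma is_pmod_std_chain: "is_pmod (std_chain p q r :: (X2, 'k::field) pmod)"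
  using fd_coord_space[where 'a = 'k]
  by (auto simp: is_pmod_def std_chain_def linear_on_def coord_space_def cutoff_def sscale_def
      fun_eq_iff)

lemma cutoff_coord_space: "r \<le> n \<Longrightarrow> cutoff r ` coord_space n = coord_space r"
proof
  assume "r \<le> n"
  then show "coord_space r \<subseteq> cutoff r ` coord_space n"
    by (auto simp: coord_space_def cutoff_def fun_eq_iff intro!: image_eqI)
qed (auto simp: coord_space_def cutoff_def)

lemma mrank_std_chain:
  "mrank (std_chain p q r) False False = r + p"
  "mrank (std_chain p q r) True True = r + q"
  "mrank (std_chain p q r) False True = r"
  by (simp_all add: mrank_def std_chain_def dim_coord_space cutoff_coord_space)

lemma chain_type_std_chain: "chain_type (std_chain p q r) = (p, q, r)"
  by (simp add: chain_type_def mrank_std_chain)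

lemma lincomb_cutoff:
  assumes "length xs = r"
  shows "lincomb (xs @ zs) (cutoff r c) = lincomb xs c"
proof -
  have "lincomb (xs @ zs) (cutoff r c)
      = (\<Sum>i<r. sscale (cutoff r c i) ((xs @ zs) ! i))"
    unfolding lincomb_def using assms
    by (intro sum.mono_neutral_right) (auto simp: cutoff_def)
  also have "\<dots> = lincomb xs c"
    unfolding lincomb_def using assms
    by (intro sum.cong) (simp_all add: cutoff_def nth_append)
  finally show ?thesis .
qed

text \<open>
  Adapted bases of the two spaces give coordinates in which the structure map is a projection.
\<close>

lemma ex_iso_std_chain:
  assumes M: "is_pmod (M :: (X2, 'k::field) pmod)"
  obtains p q r where "pmod_iso (std_chain p q r) M"
proof -
  let ?V = "pspace M False" and ?W = "pspace M True" and ?f = "pmap M False True"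
  have f: "linear_on ?V ?W ?f"
    using is_pmodD(2)[OF M] by simp
  obtain xs ys zs where bases: "basis_list (xs @ ys) ?V" "basis_list (map ?f xs @ zs) ?W"
    and ys: "\<And>y. y \<in> set ys \<Longrightarrow> ?f y = 0"
    using adapted_bases[OF is_pmodD(1)[OF M] is_pmodD(1)[OF M] f] by blast
  obtain g where g: "klinear g" "\<And>v. v \<in> ?V \<Longrightarrow> g v = ?f v"
    using linear_on_extend[OF f is_pmodD(1)[OF M]] by blast
  define S :: "(X2, 'k) pmod" where "S = std_chain (length ys) (length zs) (length xs)"
  define h where "h x = lincomb (if x then map ?f xs @ zs else xs @ ys)" for x
  have lin: "linear_on (pspace S x) (pspace M x) (h x)" for x
    using linear_on_lincomb[OF bases(1)] linear_on_lincomb[OF bases(2)]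
    by (cases x) (simp_all add: S_def h_def std_chain_def)
  have bij: "bij_betw (h x) (pspace S x) (pspace M x)" for x
    using bij_betw_lincomb[OF bases(1)] bij_betw_lincomb[OF bases(2)]
    by (cases x) (simp_all add: S_def h_def std_chain_def)
  have mem: "set (xs @ ys) \<subseteq> ?V"
    using bases(1) kseq.span_superset unfolding basis_list_def by blast
  have comm: "h True (cutoff (length xs) c) = ?f (h False c)" for c
  proof -
    have "lincomb (xs @ ys) c \<in> ?V"
      using lincomb_in_span[of "xs @ ys" c] bases(1) by (simp add: basis_list_def)
    then have "?f (h False c) = g (lincomb (xs @ ys) c)"
      by (simp add: h_def g(2))
    also have "\<dots> = (\<Sum>i<length (xs @ ys). sscale (c i) (g ((xs @ ys) ! i)))"
      unfolding lincomb_def by (simp only: kpair.linear_sum[OF g(1)] kpair.linear_scale[OF g(1)])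
    also have "\<dots> = (\<Sum>i<length (xs @ ys). sscale (c i) (?f ((xs @ ys) ! i)))"
      using mem g(2) nth_mem[of _ "xs @ ys"] by (intro sum.cong refl) (metis lessThan_iff subsetD)
    also have "\<dots> = (\<Sum>i<length xs. sscale (c i) (?f ((xs @ ys) ! i)))"
      by (intro sum.mono_neutral_right) (auto simp: nth_append ys)
    also have "\<dots> = lincomb (map ?f xs) c"
      unfolding lincomb_def by (intro sum.cong) (simp_all add: nth_append)
    finally show ?thesis
      by (simp add: h_def lincomb_cutoff)
  qed
  have "h y (pmap S x y v) = pmap M x y (h x v)" if "x \<le> y" "v \<in> pspace S x" for x y v
  proof (cases "x = y")
    case True
    have "h x v \<in> pspace M x"
      using lin[of x] that by (auto simp: linear_on_def)
    then show ?thesis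
      using True is_pmodD(3)[OF M] by (simp add: S_def std_chain_def)
  next
    case False
    then have "x = False" "y = True"
      using that by auto
    then show ?thesis
      by (simp add: S_def std_chain_def comm)
  qed
  then have "pmod_iso S M"
    unfolding pmod_iso_def using lin bij by (intro exI[of _ h]) simp
  then show thesis
    using that unfolding S_def by blast
qed

lemma chain_type_iso:
  assumes "is_pmod M" "is_pmod N" "pmod_iso M N"
  shows "chain_type M = chain_type N"
  using mrank_iso[OF assms] by (simp add: chain_type_def)

lemma pmod_iso_std_chain:
  assumes M: "is_pmod M" and "chain_type M = (p, q, r)"
  shows "pmod_iso (std_chain p q r) M"
proof -
  obtain p' q' r' where iso: "pmod_iso (std_chain p' q' r') M"
    using ex_iso_std_chain[OF M] .
  then have "(p', q', r') = (p, q, r)"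
    using chain_type_iso[OF is_pmod_std_chain M iso] assms(2) by (simp add: chain_type_std_chain)
  then show ?thesis
    using iso by simp
qed

lemma chain_iso_iff:
  assumes M: "is_pmod M" and N: "is_pmod N"
  shows "pmod_iso M N \<longleftrightarrow> chain_type M = chain_type N"
proof
  assume eq: "chain_type M = chain_type N"
  obtain p q r where "chain_type M = (p, q, r)"
    using prod_cases3 .
  then have "pmod_iso (std_chain p q r) M" "pmod_iso (std_chain p q r) N"
    using pmod_iso_std_chain M N eq by metis+
  then show "pmod_iso M N"
    using pmod_iso_sym[OF is_pmod_std_chain M] pmod_iso_trans[OF M] by blast
qed (rule chain_type_iso[OF M N])

lemma ex_chain_type:
  obtains M :: "(X2, 'k::field) pmod" where "is_pmod M" "chain_type M = t"
proof (cases t)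
  case (fields p q r)
  then show thesis
    using that[of "std_chain p q r"] by (simp add: is_pmod_std_chain chain_type_std_chain)
qed

text \<open>The truncated subtractions in \<open>chain_type\<close> are genuine ones.\<close>

lemma mrank_chain_le:
  assumes M: "is_pmod M"
  shows "mrank M False True \<le> mrank M False False" "mrank M False True \<le> mrank M True True"
proof -
  obtain p q r where "pmod_iso (std_chain p q r) M"
    using ex_iso_std_chain[OF M] .
  note eq = mrank_iso[OF is_pmod_std_chain M this]
  show "mrank M False True \<le> mrank M False False" "mrank M False True \<le> mrank M True True"
    using eq[of False False] eq[of True True] eq[of False True] by (simp_all add: mrank_std_chain)
qed

lemma chain_type_dsum:
  assumes "is_pmod M" "is_pmod N"
  shows "chain_type (M \<oplus>\<^sub>p N) = chain_type M + chain_type N"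
  using mrank_chain_le[OF assms(1)] mrank_chain_le[OF assms(2)]
  by (simp add: chain_type_def mrank_dsum[OF assms])

lemma chain_type_zero: "chain_type zero_pmod = (0, 0, 0)"
  by (simp add: chain_type_def mrank_zero)

lemma chain_type_dpower:
  assumes "is_pmod U" "chain_type U = (x, y, z)"
  shows "chain_type (dpower n U) = (n * x, n * y, n * z)"
  by (induction n) (simp_all add: chain_type_zero chain_type_dsum assms is_pmod_dpower)

text \<open>
  Being a direct summand is divisibility in \<open>\<nat>\<^sup>3\<close>: a complement of the right type always exists.
\<close>

lemma decomposition_iff_chain_type:
  fixes M N :: "(X2, 'a::field) pmod"
  assumes M: "is_pmod M" and N: "is_pmod N"
  shows "(\<exists>L. is_pmod L \<and> pmod_iso M (N \<oplus>\<^sub>p L)) \<longleftrightarrow> (\<exists>t. chain_type M = chain_type N + t)"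
proof
  assume "\<exists>t. chain_type M = chain_type N + t"
  then obtain t where "chain_type M = chain_type N + t" ..
  moreover obtain L :: "(X2, 'a) pmod" where "is_pmod L" "chain_type L = t"
    using ex_chain_type .
  ultimately show "\<exists>L. is_pmod L \<and> pmod_iso M (N \<oplus>\<^sub>p L)"
    using M N by (auto simp: chain_iso_iff is_pmod_dsum chain_type_dsum)
next
  assume "\<exists>L. is_pmod L \<and> pmod_iso M (N \<oplus>\<^sub>p L)"
  then show "\<exists>t. chain_type M = chain_type N + t"
    using M N chain_iso_iff is_pmod_dsum chain_type_dsum by metis
qed

text \<open>The atoms of the additive monoid \<open>\<nat>\<^sup>3\<close>, by the next two lemmas.\<close>

definition atomic_types :: "(nat \<times> nat \<times> nat) set"
  where "atomic_types = {(1, 0, 0), (0, 1, 0), (0, 0, 1)}"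

lemma atom_in_atomic_types:
  assumes "t \<noteq> 0" and atom: "\<And>u v. t = u + v \<Longrightarrow> u = 0 \<or> v = 0"
  shows "t \<in> atomic_types"
proof -
  obtain p q r where t: "t = (p, q, r)"
    using prod_cases3 .
  have *: "p = 0 \<or> p = 1 \<and> q = 0 \<and> r = 0"
    using atom[of "(1, 0, 0)" "(p - 1, q, r)"] by (cases p) (auto simp: t zero_prod_def)
  have "q = 0 \<or> p = 0 \<and> q = 1 \<and> r = 0"
    using atom[of "(0, 1, 0)" "(p, q - 1, r)"] by (cases q) (auto simp: t zero_prod_def)
  moreover have "r = 0 \<or> p = 0 \<and> q = 0 \<and> r = 1"
    using atom[of "(0, 0, 1)" "(p, q, r - 1)"] by (cases r) (auto simp: t zero_prod_def)
  ultimately show ?thesis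
    using * assms(1) by (auto simp: t zero_prod_def atomic_types_def)
qed

lemma atomic_types_indecomposable: "u + v \<in> atomic_types \<Longrightarrow> u = 0 \<or> v = 0"
  by (cases u; cases v) (auto simp: atomic_types_def zero_prod_def add_is_1)

lemma indecomposable_chain_iff:
  fixes U :: "(X2, 'a::field) pmod"
  shows "indecomposable U \<longleftrightarrow> is_pmod U \<and> chain_type U \<in> atomic_types"
proof -
  have zero: "pmod_iso N zero_pmod \<longleftrightarrow> chain_type N = 0" if "is_pmod N" for N :: "(X2, 'a) pmod"
    using that by (simp add: chain_iso_iff is_pmod_zero chain_type_zero zero_prod_def)
  show ?thesis
  proof
    assume U: "indecomposable U"
    then have "is_pmod U"
      by (simp add: indecomposable_def)
    have "u = 0 \<or> v = 0" if uv: "chain_type U = u + v" for u v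
    proof -
      obtain N L :: "(X2, 'a) pmod"
        where NL: "is_pmod N" "chain_type N = u" "is_pmod L" "chain_type L = v"
        using ex_chain_type by metis
      then have "pmod_iso U (N \<oplus>\<^sub>p L)"
        using uv \<open>is_pmod U\<close> by (simp add: chain_iso_iff is_pmod_dsum chain_type_dsum)
      then have "pmod_iso N zero_pmod \<or> pmod_iso L zero_pmod"
        using U NL unfolding indecomposable_def by blast
      then show ?thesis
        using NL zero by blast
    qed
    moreover have "chain_type U \<noteq> 0"
      using U zero by (auto simp: indecomposable_def)
    ultimately show "is_pmod U \<and> chain_type U \<in> atomic_types"
      using \<open>is_pmod U\<close> atom_in_atomic_types by blast
  next
    assume U: "is_pmod U \<and> chain_type U \<in> atomic_types"
    have "chain_type N = 0 \<or> chain_type L = 0"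
      if "is_pmod N" "is_pmod L" "pmod_iso U (N \<oplus>\<^sub>p L)" for N L
      using that U atomic_types_indecomposable by (simp add: chain_iso_iff is_pmod_dsum chain_type_dsum)
    moreover have "chain_type U \<noteq> 0"
      using U by (auto simp: atomic_types_def zero_prod_def)
    ultimately show "indecomposable U"
      using U zero unfolding indecomposable_def by blast
  qed
qed

lemma ex_Ind_chain_type:
  fixes S :: "(X2, 'a::field) pmod set"
  assumes S: "is_Ind S" and t: "t \<in> atomic_types"
  obtains U where "U \<in> S" "chain_type U = t"
proof -
  obtain M :: "(X2, 'a) pmod" where M: "is_pmod M" "chain_type M = t"
    using ex_chain_type .
  then have "indecomposable M"
    using t by (simp add: indecomposable_chain_iff)
  then obtain U where U: "U \<in> S" "pmod_iso M U"
    using S unfolding is_Ind_def by blast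
  then have "is_pmod U"
    using S by (auto simp: is_Ind_def indecomposable_def)
  then show thesis
    using that U chain_type_iso[OF M(1) _ U(2)] M(2) by simp
qed

text \<open>
  Exactly one of \<open>x\<close>, \<open>y\<close>, \<open>z\<close> is \<open>1\<close>, so the right-hand side selects one coordinate: the largest \<open>n\<close>
  for which \<open>(p, q, r) - n (x, y, z)\<close> stays in \<open>\<nat>\<^sup>3\<close>.
\<close>

lemma multiplicity_chain:
  assumes U: "is_pmod U" "chain_type U = (x, y, z)" "(x, y, z) \<in> atomic_types"
    and M: "is_pmod M" "chain_type M = (p, q, r)"
  shows "multiplicity U M = x * p + y * q + z * r"
proof -
  have "(\<exists>L. is_pmod L \<and> pmod_iso M (dpower n U \<oplus>\<^sub>p L)) \<longleftrightarrow> n * x \<le> p \<and> n * y \<le> q \<and> n * z \<le> r" for n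
    using U M
    by (simp add: decomposition_iff_chain_type is_pmod_dpower chain_type_dpower[OF U(1,2)] le_iff_add)
  then show ?thesis
    unfolding multiplicity_def using U(3)
    by (intro Greatest_equality) (auto simp: atomic_types_def)
qed


section \<open>Equivalence of lifted invariants\<close>

lemma K0_class_in_K0sp: "is_pmod M \<Longrightarrow> K0_class M \<in> carrier K0sp"
  unfolding K0_class_def K0sp_def carrier_FactGroup
  by (intro imageI) (simp add: isoclass_in_isoclasses)

lemma group_K0sp: "group K0sp"
  unfolding K0sp_def by (rule normal.factorgroup_is_group[OF K0_subgroup_normal])

text \<open>
  If an injective homomorphism \<open>T\<close> of the ambient groups carries \<open>\<phi>\<close> to \<open>\<psi>\<close> on every module, then
  isomorphism invariance and additivity pass from \<open>\<phi>\<close> to \<open>\<psi>\<close>, and \<open>T\<close> restricts to the isomorphism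
  between the images of the two lifts, because a homomorphism on the split Grothendieck group is
  determined by the classes of modules.
\<close>

lemma equivalent_K0_lifts:
  fixes \<phi> :: "('p::{finite,order}, 'k::field) pmod \<Rightarrow> 'i \<Rightarrow> int" and \<psi> :: "('p, 'k) pmod \<Rightarrow> 'j \<Rightarrow> int"
  assumes iso: "\<And>M N i. is_pmod M \<Longrightarrow> is_pmod N \<Longrightarrow> pmod_iso M N \<Longrightarrow> i \<in> I \<Longrightarrow> \<phi> M i = \<phi> N i"
    and add: "\<And>M N i. is_pmod M \<Longrightarrow> is_pmod N \<Longrightarrow> i \<in> I \<Longrightarrow> \<phi> (M \<oplus>\<^sub>p N) i = \<phi> M i + \<phi> N i"
    and T: "T \<in> hom (Zpow I) (Zpow J)" and inj: "inj_on T (carrier (Zpow I))"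
    and \<psi>: "\<And>M. is_pmod M \<Longrightarrow> restrict (\<psi> M) J = T (restrict (\<phi> M) I)"
  shows "equivalent_invariants I (K0_lift I \<phi>) J (K0_lift J \<psi>)"
proof -
  let ?\<Phi> = "K0_lift I \<phi>" and ?\<Psi> = "K0_lift J \<psi>" and ?K = "K0sp :: (('p, 'k) pmod set \<Rightarrow>\<^sub>0 int) set monoid"
  have \<psi>_at: "\<psi> M j = T (restrict (\<phi> M) I) j" if "is_pmod M" "j \<in> J" for M j
    using fun_cong[OF \<psi>[OF that(1)], of j] that(2) by simp
  have \<psi>_iso: "\<psi> M j = \<psi> N j" if "is_pmod M" "is_pmod N" "pmod_iso M N" "j \<in> J" for M N j
  proof -
    have "restrict (\<phi> M) I = restrict (\<phi> N) I"
      using that by (intro restrict_ext) (rule iso)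
    then show ?thesis
      using that by (simp add: \<psi>_at)
  qed
  have \<psi>_add: "\<psi> (M \<oplus>\<^sub>p N) j = \<psi> M j + \<psi> N j" if "is_pmod M" "is_pmod N" "j \<in> J" for M N j
  proof -
    let ?m = "restrict (\<phi> M) I" and ?n = "restrict (\<phi> N) I"
    have "restrict (\<phi> (M \<oplus>\<^sub>p N)) I = ?m \<otimes>\<^bsub>Zpow I\<^esub> ?n"
      using that by (auto simp: add intro!: restrict_ext)
    moreover have "T (?m \<otimes>\<^bsub>Zpow I\<^esub> ?n) = T ?m \<otimes>\<^bsub>Zpow J\<^esub> T ?n"
      by (rule hom_mult[OF T]) auto
    ultimately show ?thesis
      using that by (simp add: \<psi>_at is_pmod_dsum)
  qed
  have \<Phi>: "?\<Phi> \<in> hom ?K (Zpow I)" and \<Phi>_class: "\<And>M. is_pmod M \<Longrightarrow> ?\<Phi> (K0_class M) = restrict (\<phi> M) I"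
    by (rule K0_lift_hom K0_lift_class; use iso add in blast)+
  have \<Psi>: "?\<Psi> \<in> hom ?K (Zpow J)" and \<Psi>_class: "\<And>M. is_pmod M \<Longrightarrow> ?\<Psi> (K0_class M) = restrict (\<psi> M) J"
    by (rule K0_lift_hom K0_lift_class; use \<psi>_iso \<psi>_add in blast)+
  have restrict_eq: "restrict ?\<Psi> (carrier ?K) = restrict (T \<circ> ?\<Phi>) (carrier ?K)"
  proof (rule K0_hom_unique)
    show "restrict ?\<Psi> (carrier ?K) \<in> hom ?K (Zpow J)"
      by (rule group.hom_restrict[OF group_K0sp \<Psi>]) simp
    show "restrict (T \<circ> ?\<Phi>) (carrier ?K) \<in> hom ?K (Zpow J)"
      by (rule group.hom_restrict[OF group_K0sp hom_compose[OF \<Phi> T]]) simp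
    fix M :: "('p, 'k) pmod" assume "is_pmod M"
    then show "restrict ?\<Psi> (carrier ?K) (K0_class M) = restrict (T \<circ> ?\<Phi>) (carrier ?K) (K0_class M)"
      by (simp add: K0_class_in_K0sp \<Phi>_class \<Psi>_class \<psi>)
  qed auto
  have eq: "T (?\<Phi> x) = ?\<Psi> x" if "x \<in> carrier ?K" for x
    using fun_cong[OF restrict_eq, of x] that by simp
  have im: "?\<Phi> ` carrier ?K \<subseteq> carrier (Zpow I)"
    using hom_carrier[OF \<Phi>] .
  have "T ` (?\<Phi> ` carrier ?K) = ?\<Psi> ` carrier ?K"
    by (simp add: image_image eq)
  then have "bij_betw T (?\<Phi> ` carrier ?K) (?\<Psi> ` carrier ?K)"
    using inj_on_subset[OF inj im] by (simp add: bij_betw_def)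
  moreover have "T (u \<otimes>\<^bsub>Zpow I\<^esub> v) = T u \<otimes>\<^bsub>Zpow J\<^esub> T v"
    if "u \<in> ?\<Phi> ` carrier ?K" "v \<in> ?\<Phi> ` carrier ?K" for u v
    using that im by (intro hom_mult[OF T]) auto
  ultimately have "T \<in> iso (invariant_image I ?\<Phi>) (invariant_image J ?\<Psi>)"
    by (auto simp: iso_def hom_def invariant_image_def bij_betw_def)
  then show ?thesis
    unfolding equivalent_invariants_def invariant_def using \<Phi> \<Psi> eq by blast
qed


section \<open>Ranks and multiplicities\<close>

lemma order_embedding_mono: "order_embedding f \<Longrightarrow> x \<le> y \<Longrightarrow> f x \<le> f y"
  by (metis order_embedding_def)

lemma some_Emb_embedding:
  assumes "c \<in> Emb"
  shows "order_embedding (SOME f. f \<in> c)"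
proof -
  obtain f where f: "order_embedding f"
    "c = {g. order_embedding g \<and> (\<exists>\<sigma>. order_automorphism \<sigma> \<and> g = f \<circ> \<sigma>)}"
    using assms by (auto simp: Emb_def quotient_def)
  have "order_automorphism id"
    by (simp add: order_automorphism_def order_embedding_def)
  then have "f \<in> c"
    using f by (metis (mono_tags, lifting) comp_id mem_Collect_eq)
  then have "(SOME f. f \<in> c) \<in> c"
    by (rule someI[where P = "\<lambda>f. f \<in> c"])
  then show ?thesis
    using f(2) by blast
qed

lemma X2_automorphism:
  assumes "order_automorphism (\<sigma> :: X2 \<Rightarrow> X2)"
  shows "\<sigma> = id"
proof -
  have "\<sigma> False \<le> \<sigma> True"
    using assms order_embedding_mono[of \<sigma> False True] by (simp add: order_automorphism_def)
  moreover have "\<sigma> False \<noteq> \<sigma> True"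
    using assms by (simp add: order_automorphism_def bij_def inj_eq)
  ultimately have "\<sigma> x = x" for x
    by (cases x) auto
  then show ?thesis
    by (simp add: fun_eq_iff)
qed

text \<open>
  As the two-element chain is rigid, a class in \<open>Emb\<close> is a singleton, and its chosen representative
  is the only one.
\<close>

lemma ex_Emb_pair:
  fixes a b :: "'p::{finite,order}"
  assumes "a < b"
  obtains c :: "(X2 \<Rightarrow> 'p) set"
  where "c \<in> Emb" "(SOME f. f \<in> c) False = a" "(SOME f. f \<in> c) True = b"
proof -
  let ?f = "\<lambda>x. if x then b else a"
  have f: "order_embedding ?f"
    using assms by (auto simp: order_embedding_def)
  have id: "order_automorphism (id :: X2 \<Rightarrow> X2)"
    by (simp add: order_automorphism_def order_embedding_def)
  let ?r = "{(f :: X2 \<Rightarrow> 'p, g). order_embedding f \<and> order_embedding g \<and>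
             (\<exists>\<sigma>. order_automorphism \<sigma> \<and> g = f \<circ> \<sigma>)}"
  have "?r `` {?f} = {?f}"
  proof -
    have "g = ?f" if "(?f, g) \<in> ?r" for g
      using that by (auto dest: X2_automorphism)
    moreover have "(?f, ?f) \<in> ?r"
      using f id by (auto intro!: exI[of _ id])
    ultimately show ?thesis
      by blast
  qed
  moreover have "?r `` {?f} \<in> Emb"
    unfolding Emb_def using f by (intro quotientI) simp
  ultimately show thesis
    using that[of "{?f}"] by simp
qed

lemma connected_poset_neighbour:
  fixes a :: "'p::{finite,order}"
  assumes "connected_poset TYPE('p)" and "card (UNIV :: 'p set) \<ge> 2"
  obtains b where "a < b \<or> b < a"
proof -
  have "\<exists>b :: 'p. b \<noteq> a"
  proof (rule ccontr)
    assume "\<not> (\<exists>b. b \<noteq> a)"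
    then have "(UNIV :: 'p set) = {a}"
      by auto
    then have "card (UNIV :: 'p set) = card {a}"
      by simp
    then show False
      using assms(2) by simp
  qed
  then obtain b where b: "b \<noteq> a"
    by blast
  have "(\<lambda>x y. x \<le> y \<or> y \<le> x)\<^sup>*\<^sup>* a b"
    using assms(1) by (simp add: connected_poset_def)
  then have "b = a \<or> (\<exists>c. a < c \<or> c < a)"
    by (induction rule: rtranclp_induct) (auto simp: order.order_iff_strict)
  then show thesis
    using b that by blast
qed

text \<open>
  The linear function \<open>T\<close> of the introduction. The coefficients \<open>x\<close>, \<open>y\<close>, \<open>z\<close> select the formula for
  the isomorphism type of \<open>U\<close>, which avoids fixing representatives.
\<close>

definition mult_of_rk ::
  "(X2, 'k::field) pmod set \<Rightarrow> ('p::{finite,order} \<times> 'p \<Rightarrow> int)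
    \<Rightarrow> (X2 \<Rightarrow> 'p) set \<times> (X2, 'k) pmod \<Rightarrow> int"
  where "mult_of_rk S \<rho> = (\<lambda>(c, U) \<in> mult_index S.
    let a = (SOME f. f \<in> c) False; b = (SOME f. f \<in> c) True; (x, y, z) = chain_type U
    in int x * (\<rho> (a, a) - \<rho> (a, b)) + int y * (\<rho> (b, b) - \<rho> (a, b)) + int z * \<rho> (a, b))"

lemma mult_of_rk_hom: "mult_of_rk S \<in> hom (Zpow leq_pairs) (Zpow (mult_index S))"
proof (rule homI)
  fix \<rho> \<rho>' :: "'a \<times> 'a \<Rightarrow> int"
  show "mult_of_rk S (\<rho> \<otimes>\<^bsub>Zpow leq_pairs\<^esub> \<rho>')
      = mult_of_rk S \<rho> \<otimes>\<^bsub>Zpow (mult_index S)\<^esub> mult_of_rk S \<rho>'"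
  proof -
    have "(SOME f. f \<in> c) False \<le> (SOME f. f \<in> c) True" if "c \<in> Emb" for c :: "(X2 \<Rightarrow> 'a) set"
      by (rule order_embedding_mono[OF some_Emb_embedding[OF that]]) simp
    then show ?thesis
      by (auto simp: mult_of_rk_def mult_index_def leq_pairs_def Let_def fun_eq_iff restrict_def
          algebra_simps split: prod.splits)
  qed
qed (auto simp: mult_of_rk_def)

text \<open>
  For \<open>a < b\<close> the component at \<open>k \<rightarrow> k\<close> is the rank at \<open>(a, b)\<close>. The dimension at \<open>a\<close> is recovered
  from any comparable \<open>b \<noteq> a\<close>, through \<open>k \<rightarrow> 0\<close> if \<open>a < b\<close> and through \<open>0 \<rightarrow> k\<close> if \<open>b < a\<close>.
\<close>

lemma mult_of_rk_inj:
  assumes P: "connected_poset TYPE('p::{finite,order})" "card (UNIV :: 'p set) \<ge> 2"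
    and S: "is_Ind (S :: (X2, 'k::field) pmod set)"
  shows "inj_on (mult_of_rk S) (carrier (Zpow (leq_pairs :: ('p \<times> 'p) set)))"
proof (rule inj_onI)
  fix \<rho> \<rho>' :: "'p \<times> 'p \<Rightarrow> int"
  assume ext: "\<rho> \<in> carrier (Zpow leq_pairs)" "\<rho>' \<in> carrier (Zpow leq_pairs)"
    and eq: "mult_of_rk S \<rho> = mult_of_rk S \<rho>'"
  have comp: "int x * (\<rho> (a, a) - \<rho> (a, b)) + int y * (\<rho> (b, b) - \<rho> (a, b)) + int z * \<rho> (a, b)
      = int x * (\<rho>' (a, a) - \<rho>' (a, b)) + int y * (\<rho>' (b, b) - \<rho>' (a, b)) + int z * \<rho>' (a, b)"
    if "a < b" and xyz: "(x, y, z) \<in> atomic_types" for a b x y z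
  proof -
    obtain c :: "(X2 \<Rightarrow> 'p) set"
      where c: "c \<in> Emb" "(SOME f. f \<in> c) False = a" "(SOME f. f \<in> c) True = b"
      using ex_Emb_pair[OF \<open>a < b\<close>] .
    obtain U where U: "U \<in> S" "chain_type U = (x, y, z)"
      using ex_Ind_chain_type[OF S xyz] .
    show ?thesis
      using fun_cong[OF eq, of "(c, U)"] c U by (simp add: mult_of_rk_def mult_index_def)
  qed
  have strict: "\<rho> (a, b) = \<rho>' (a, b)" if "a < b" for a b
    using comp[OF that, of 0 0 1] by (simp add: atomic_types_def)
  have diag: "\<rho> (a, a) = \<rho>' (a, a)" for a
  proof -
    obtain b where "a < b \<or> b < a"
      using connected_poset_neighbour[OF P] .
    then show ?thesis
    proof
      assume "a < b"
      then show ?thesis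
        using comp[of a b 1 0 0] strict[of a b] by (simp add: atomic_types_def)
    next
      assume "b < a"
      then show ?thesis
        using comp[of b a 0 1 0] strict[of b a] by (simp add: atomic_types_def)
    qed
  qed
  have "\<rho> p = \<rho>' p" if "p \<in> leq_pairs" for p
    using that strict diag by (auto simp: leq_pairs_def order.order_iff_strict)
  then show "\<rho> = \<rho>'"
    using ext by (auto simp: PiE_def intro: extensionalityI)
qed

lemma multiplicity_eq_mult_of_rk:
  fixes M :: "('p::{finite,order}, 'k::field) pmod"
  assumes S: "is_Ind S" and M: "is_pmod M"
  shows "restrict (\<lambda>(c, U). int (multiplicity U (pullback (SOME f. f \<in> c) M))) (mult_index S)
    = mult_of_rk S (restrict (\<lambda>(a, b). int (mrank M a b)) leq_pairs)"
  unfolding mult_of_rk_def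
proof (intro restrict_ext, clarify)
  fix c :: "(X2 \<Rightarrow> 'p) set" and U :: "(X2, 'k) pmod"
  assume "(c, U) \<in> mult_index S"
  then have "c \<in> Emb" "U \<in> S"
    by (simp_all add: mult_index_def)
  define f where "f = (SOME f. f \<in> c)"
  have f: "order_embedding f"
    unfolding f_def by (rule some_Emb_embedding[OF \<open>c \<in> Emb\<close>])
  then have le: "f False \<le> f True"
    by (rule order_embedding_mono) simp
  have U: "is_pmod U" "chain_type U \<in> atomic_types"
    using S \<open>U \<in> S\<close> by (auto simp: is_Ind_def indecomposable_chain_iff)
  obtain x y z where xyz: "chain_type U = (x, y, z)"
    using prod_cases3 .
  let ?\<rho> = "restrict (\<lambda>(a, b). int (mrank M a b)) leq_pairs"
  note fM = is_pmod_pullback[OF M f]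
  have "multiplicity U (pullback f M) = x * (mrank M (f False) (f False) - mrank M (f False) (f True))
      + y * (mrank M (f True) (f True) - mrank M (f False) (f True)) + z * mrank M (f False) (f True)"
    using U(2) unfolding xyz
    by (intro multiplicity_chain[OF U(1) xyz _ fM]) (simp_all add: chain_type_def mrank_pullback)
  moreover have "mrank M (f False) (f True) \<le> mrank M (f False) (f False)"
    "mrank M (f False) (f True) \<le> mrank M (f True) (f True)"
    using mrank_chain_le[OF fM] by (simp_all add: mrank_pullback)
  ultimately show "int (multiplicity U (pullback (SOME f. f \<in> c) M)) =
      (let a = (SOME f. f \<in> c) False; b = (SOME f. f \<in> c) True; (x, y, z) = chain_type U
       in int x * (?\<rho> (a, a) - ?\<rho> (a, b)) + int y * (?\<rho> (b, b) - ?\<rho> (a, b)) + int z * ?\<rho> (a, b))"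
    unfolding f_def[symmetric] using le by (simp add: xyz leq_pairs_def of_nat_diff Let_def)
qed

theorem corollary3p8:
  fixes Ind_X2 :: "(X2, 'k::field) pmod set"
  assumes "connected_poset TYPE('p::{finite,order})"
    and "card (UNIV :: 'p set) \<ge> 2"
    and "is_Ind Ind_X2"
  shows "equivalent_invariants
    leq_pairs (rk_inv :: (('p, 'k) pmod set \<Rightarrow>\<^sub>0 int) set \<Rightarrow> 'p \<times> 'p \<Rightarrow> int)
    (mult_index Ind_X2) (mult_inv Ind_X2)"
  unfolding rk_inv_def mult_inv_def mrank_def[symmetric]
proof (rule equivalent_K0_lifts)
  show "mult_of_rk Ind_X2 \<in> hom (Zpow (leq_pairs :: ('p \<times> 'p) set)) (Zpow (mult_index Ind_X2))"
    by (rule mult_of_rk_hom)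
  show "inj_on (mult_of_rk Ind_X2) (carrier (Zpow (leq_pairs :: ('p \<times> 'p) set)))"
    by (rule mult_of_rk_inj[OF assms])
qed (auto simp: leq_pairs_def mrank_iso mrank_dsum multiplicity_eq_mult_of_rk[OF assms(3)])

end
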